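(* Consider the following game. Two players, Maker and Breaker, play in timesteps $t=1,2,3,\dots$; in timestep $t$ Maker first claims $t$ previously unclaimed points of $\mathbb{Z}^2$, and then Breaker claims $t$ previously unclaimed points of $\mathbb{Z}^2$. Fix $n$. Maker wins as soon as he has a winning line segment: $n$ points claimed by Maker lying on a common straight line (of any direction), such that no point claimed by Breaker lies on that line between the first and the last of these $n$ points (the $n$ points need not be consecutive, and other points of either player may lie on the line). Then Breaker can stop Maker from winning before time $(1-o(1))n$; that is, for every $\delta>0$ and all sufficiently large $n$, Breaker has a strategy guaranteeing that Maker has no winning line segment before timestep $(1-\delta)n$.
   Context: A timestep consists of one turn of Maker followed by one turn of Breaker. Maker's winning condition depends on Breaker's points, so this is not a standard Maker-Breaker game. *)

theory Defs
  imports "HOL-Analysis.Analysis"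
begin

type_synonym point = "int \<times> int"

text \<open>A turn is the set of points claimed in it. A strategy of Breaker maps the completed
  timesteps (pairs of Maker's and Breaker's turn) and Maker's current turn to Breaker's reply.\<close>

type_synonym turn = "point set"
type_synonym breaker_strategy = "(turn \<times> turn) list \<Rightarrow> turn \<Rightarrow> turn"

definition real_point :: "point \<Rightarrow> real \<times> real" where
  "real_point p = (real_of_int (fst p), real_of_int (snd p))"

text \<open>In the next definition \<open>a\<close> and \<open>b\<close> are the first and the last of the \<open>n\<close> points;
  \<open>P\<close> and \<open>Q\<close> are the points claimed by Maker and by Breaker.\<close>

definition winning_segment :: "nat \<Rightarrow> point set \<Rightarrow> point set \<Rightarrow> bool" where
  "winning_segment n P Q \<longleftrightarrow>
     (\<exists>S\<subseteq>P. finite S \<and> card S = n \<and> collinear (real_point ` S) \<and>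
       (\<exists>a\<in>S. \<exists>b\<in>S.
          real_point ` S \<subseteq> closed_segment (real_point a) (real_point b) \<and>
          real_point ` Q \<inter> closed_segment (real_point a) (real_point b) = {}))"

text \<open>Below, \<open>M t\<close> and \<open>B t\<close> are the turns of Maker and Breaker in timestep \<open>t \<ge> 1\<close>;
  the values at \<open>0\<close> are never used.\<close>

definition claimed :: "(nat \<Rightarrow> turn) \<Rightarrow> nat \<Rightarrow> point set" where
  "claimed X t = (\<Union>s\<in>{1..t}. X s)"

definition legal_turn :: "nat \<Rightarrow> point set \<Rightarrow> turn \<Rightarrow> bool" where
  "legal_turn t C X \<longleftrightarrow> finite X \<and> card X = t \<and> X \<inter> C = {}"

definition legal_maker_turn :: "(nat \<Rightarrow> turn) \<Rightarrow> (nat \<Rightarrow> turn) \<Rightarrow> nat \<Rightarrow> bool" where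
  "legal_maker_turn M B t \<longleftrightarrow> legal_turn t (claimed M (t - 1) \<union> claimed B (t - 1)) (M t)"

definition legal_breaker_turn :: "(nat \<Rightarrow> turn) \<Rightarrow> (nat \<Rightarrow> turn) \<Rightarrow> nat \<Rightarrow> bool" where
  "legal_breaker_turn M B t \<longleftrightarrow> legal_turn t (claimed M t \<union> claimed B (t - 1)) (B t)"

definition history :: "(nat \<Rightarrow> turn) \<Rightarrow> (nat \<Rightarrow> turn) \<Rightarrow> nat \<Rightarrow> (turn \<times> turn) list" where
  "history M B t = map (\<lambda>s. (M s, B s)) [1..<t]"

text \<open>The first \<open>T\<close> timesteps of a game in which Maker plays legally and Breaker follows
  \<open>\<sigma>\<close>. Only finite plays are considered: were Maker required to move legally forever, an illegal
  \<open>\<sigma>\<close> that leaves Maker no points to claim would satisfy the definitions below vacuously.\<close>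

definition play :: "breaker_strategy \<Rightarrow> (nat \<Rightarrow> turn) \<Rightarrow> (nat \<Rightarrow> turn) \<Rightarrow> nat \<Rightarrow> bool" where
  "play \<sigma> M B T \<longleftrightarrow>
     (\<forall>t\<in>{1..T}. legal_maker_turn M B t \<and> B t = \<sigma> (history M B t) (M t))"

definition legal_strategy :: "breaker_strategy \<Rightarrow> bool" where
  "legal_strategy \<sigma> \<longleftrightarrow>
     (\<forall>M B T. play \<sigma> M B T \<longrightarrow> (\<forall>t\<in>{1..T}. legal_breaker_turn M B t))"

text \<open>It suffices to inspect the position right after Maker's turn: a winning segment stays one
  when Maker gains points and Breaker loses points, so one that is present at any other moment of
  timestep \<open>t\<close> is also present then.\<close>

definition no_win_before :: "breaker_strategy \<Rightarrow> nat \<Rightarrow> real \<Rightarrow> bool" where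
  "no_win_before \<sigma> n \<tau> \<longleftrightarrow>
     (\<forall>M B T. play \<sigma> M B T \<longrightarrow>
        (\<forall>t\<in>{1..T}. real t < \<tau> \<longrightarrow> \<not> winning_segment n (claimed M t) (claimed B (t - 1))))"

end

theory Submission
  imports Defs
begin

text \<open>Call a cell a component of a line minus Breaker's points that still contains an unclaimed
  point. With \<open>O(1/\<delta>)\<close> points Breaker can confine a cell: afterwards every Breaker-free piece of it
  is either full, so that Maker can never extend it, or contains at most \<open>\<delta>n/4\<close> Maker points. As Maker
  gains fewer than \<open>(1 - \<delta>)n\<close> points per turn, he cannot win if after each of Breaker's turns no cell
  contains \<open>\<delta>n\<close> Maker points. In each turn Breaker confines as many cells with \<open>\<delta>n/2\<close> Maker points as
  he can afford, preferring those with \<open>\<delta>n\<close>.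

  Two cells share at most one point, so there are at most \<open>2N/k\<close> cells with \<open>k\<close> points out of a given
  set of \<open>N < k\<^sup>2/4\<close> points. Hence early in the game Breaker can afford to confine all cells with \<open>\<delta>n\<close>
  Maker points. Later, consider the last \<open>\<beta>n\<close> timesteps for a small constant \<open>\<beta>\<close>. Few cells can have
  gained \<open>\<delta>n/2\<close> points in them, so Breaker is in trouble only if there is a cell which had \<open>\<delta>n/2\<close>
  points throughout. Then Breaker's budget was exhausted in each of these timesteps, so that he
  confined a constant times \<open>n\<^sup>2\<close> cells. But each time a cell is confined it contains about \<open>\<delta>n/4\<close>
  new Maker points, so this number is bounded by the number of incidences of the at most \<open>n\<^sup>2\<close> Maker
  points with lines that contain \<open>\<delta>n/2\<close> of them, divided by \<open>\<delta>n/4\<close>. These incidences are \<open>o(n\<^sup>3)\<close>: this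
  follows from the Szemeredi--Trotter theorem, but also from repeatedly cutting the point set into
  four equal parts by two lines, since any line misses one of the four parts.\<close>

section \<open>Lattice lines\<close>

text \<open>A line is its set of lattice points, so lines are compared as sets. Integer coefficients
  suffice because any line through two lattice points has such an equation.\<close>

definition lattice_lines :: "point set set" where
  "lattice_lines = {{p. a * fst p + b * snd p = c} | a b c. (a, b) \<noteq> (0, 0)}"

text \<open>The normal \<open>(a, b)\<close> is orthogonal to \<open>q - p\<close>, so incidence
  with \<open>r\<close> amounts to the vanishing of a cross product. The right-hand side does not
  mention \<open>l\<close>, hence two points determine a lattice line.\<close>

lemma lattice_line_eq:
  assumes "l \<in> lattice_lines" "p \<in> l" "q \<in> l" "p \<noteq> q"
  shows "l = {r. (fst r - fst p) * (snd q - snd p) = (snd r - snd p) * (fst q - fst p)}"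
proof -
  obtain a b c where l: "l = {p. a * fst p + b * snd p = c}" and ab: "(a, b) \<noteq> (0, 0)"
    using assms(1) unfolding lattice_lines_def by blast
  define dx dy where "dx = fst q - fst p" and "dy = snd q - snd p"
  have d: "dx \<noteq> 0 \<or> dy \<noteq> 0"
    using assms(4) by (auto simp: dx_def dy_def prod_eq_iff)
  have ad: "a * dx + b * dy = 0"
    using assms(2,3) by (simp add: l dx_def dy_def algebra_simps)
  have "r \<in> l \<longleftrightarrow> (fst r - fst p) * dy = (snd r - snd p) * dx" for r
  proof -
    define X Y where "X = fst r - fst p" and "Y = snd r - snd p"
    have *: "r \<in> l \<longleftrightarrow> a * X + b * Y = 0"
      using assms(2) by (auto simp: l X_def Y_def algebra_simps)
    \<comment> \<open>The first two identities give one direction, as \<open>a\<close> or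
      \<open>b\<close> is nonzero; the last two give the converse, as \<open>dx\<close> or
      \<open>dy\<close> is nonzero.\<close>
    have "a * (X * dy - Y * dx) = (a * X + b * Y) * dy - (a * dx + b * dy) * Y"
      "b * (X * dy - Y * dx) = (a * dx + b * dy) * X - (a * X + b * Y) * dx"
      "dx * (a * X + b * Y) = X * (a * dx + b * dy) - b * (X * dy - Y * dx)"
      "dy * (a * X + b * Y) = Y * (a * dx + b * dy) + a * (X * dy - Y * dx)"
      by (simp_all add: algebra_simps)
    then have "a * X + b * Y = 0 \<longleftrightarrow> X * dy - Y * dx = 0"
      using ad d ab by auto
    then show ?thesis
      unfolding * by (simp add: X_def Y_def)
  qed
  then show ?thesis
    by (auto simp: dx_def dy_def)
qed

lemma lattice_lines_meet:
  assumes "l \<in> lattice_lines" "l' \<in> lattice_lines" "p \<in> l" "q \<in> l" "p \<in> l'" "q \<in> l'" "p \<noteq> q"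
  shows "l = l'"
  using lattice_line_eq[OF assms(1,3,4,7)] lattice_line_eq[OF assms(2,5,6,7)] by simp

text \<open>Position along the direction \<open>(- b, a)\<close>. The set \<open>l\<close> has
  several equations, so one is chosen; another choice only rescales or reverses the coordinate. It
  reduces cells to the order on the integers.\<close>

definition line_coord :: "point set \<Rightarrow> point \<Rightarrow> int" where
  "line_coord l = (SOME \<tau>. \<exists>a b c. (a, b) \<noteq> (0, 0) \<and> l = {p. a * fst p + b * snd p = c} \<and>
     \<tau> = (\<lambda>p. a * snd p - b * fst p))"

lemma line_coordE:
  assumes "l \<in> lattice_lines"
  obtains a b c where "(a, b) \<noteq> (0, 0)" "l = {p. a * fst p + b * snd p = c}"
    "line_coord l = (\<lambda>p. a * snd p - b * fst p)"
proof -
  have "\<exists>\<tau> a b c. (a, b) \<noteq> (0, 0) \<and> l = {p. a * fst p + b * snd p = c} \<and>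
     \<tau> = (\<lambda>p. a * snd p - b * fst p)"
    using assms unfolding lattice_lines_def by blast
  from someI_ex[OF this] show ?thesis
    using that unfolding line_coord_def by blast
qed

lemma line_coord_param:
  assumes "l \<in> lattice_lines"
  shows "\<exists>u v :: real. \<forall>p\<in>l. \<forall>q\<in>l.
     real_of_int (fst p) - real_of_int (fst q) = u * (real_of_int (line_coord l p) - real_of_int (line_coord l q)) \<and>
     real_of_int (snd p) - real_of_int (snd q) = v * (real_of_int (line_coord l p) - real_of_int (line_coord l q))"
proof -
  obtain a b c where abc: "(a, b) \<noteq> (0, 0)" "l = {p. a * fst p + b * snd p = c}"
    "line_coord l = (\<lambda>p. a * snd p - b * fst p)"
    using line_coordE[OF assms] .
  define A B where "A = real_of_int a" and "B = real_of_int b"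
  have s: "A * A + B * B > 0"
    using abc(1) unfolding A_def B_def
    by (metis of_int_eq_0_iff prod.inject sum_squares_gt_zero_iff)
  show ?thesis
  \<comment> \<open>The witnesses solve the linear system that \<open>A * X + B * Y = 0\<close> and
    the value of \<open>A * Y - B * X\<close> form; its determinant is
    \<open>A * A + B * B\<close>.\<close>
  proof (rule exI[of _ "- B / (A * A + B * B)"], rule exI[of _ "A / (A * A + B * B)"], intro ballI)
    fix p q assume pq: "p \<in> l" "q \<in> l"
    define X Y where "X = real_of_int (fst p) - real_of_int (fst q)"
      and "Y = real_of_int (snd p) - real_of_int (snd q)"
    have "a * fst p + b * snd p = a * fst q + b * snd q"
      using pq by (simp add: abc)
    then have "real_of_int (a * fst p + b * snd p) = real_of_int (a * fst q + b * snd q)"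
      by (rule arg_cong)
    then have 0: "A * X + B * Y = 0"
      by (simp add: A_def B_def X_def Y_def algebra_simps)
    have t: "real_of_int (line_coord l p) - real_of_int (line_coord l q) = A * Y - B * X"
      by (simp add: abc(3) A_def B_def X_def Y_def algebra_simps)
    have "X * (A * A + B * B) = A * (A * X + B * Y) - B * (A * Y - B * X)"
      "Y * (A * A + B * B) = B * (A * X + B * Y) + A * (A * Y - B * X)"
      by (simp_all add: algebra_simps)
    then have "X * (A * A + B * B) = - B * (A * Y - B * X)" "Y * (A * A + B * B) = A * (A * Y - B * X)"
      unfolding 0 by simp_all
    then have "X = (- B * (A * Y - B * X)) / (A * A + B * B)" "Y = (A * (A * Y - B * X)) / (A * A + B * B)"
      using s by (metis less_irrefl nonzero_mult_div_cancel_right)+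
    then have "X = - B / (A * A + B * B) * (A * Y - B * X)" "Y = A / (A * A + B * B) * (A * Y - B * X)"
      unfolding times_divide_eq_left by blast+
    then show "real_of_int (fst p) - real_of_int (fst q) = - B / (A * A + B * B) * (real_of_int (line_coord l p) - real_of_int (line_coord l q)) \<and>
       real_of_int (snd p) - real_of_int (snd q) = A / (A * A + B * B) * (real_of_int (line_coord l p) - real_of_int (line_coord l q))"
      unfolding t by (simp add: X_def Y_def)
  qed
qed

lemma inj_on_line_coord:
  assumes "l \<in> lattice_lines"
  shows "inj_on (line_coord l) l"
proof -
  obtain u v :: real where uv: "\<forall>p\<in>l. \<forall>q\<in>l.
     real_of_int (fst p) - real_of_int (fst q) = u * (real_of_int (line_coord l p) - real_of_int (line_coord l q)) \<and>
     real_of_int (snd p) - real_of_int (snd q) = v * (real_of_int (line_coord l p) - real_of_int (line_coord l q))"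
    using line_coord_param[OF assms] by blast
  show ?thesis
  proof (rule inj_onI)
    fix p q assume "p \<in> l" "q \<in> l" "line_coord l p = line_coord l q"
    with bspec[OF bspec[OF uv], of p q] show "p = q" by (simp add: prod_eq_iff)
  qed
qed

text \<open>A line cannot meet all four open quadrants cut out by two affine functions: comparing
  diagonally opposite quadrants, both functions would vary along the line with the same sign and
  with opposite signs.\<close>

lemma line_misses_quadrant:
  fixes u v :: "point \<Rightarrow> real"
  assumes l: "l \<in> lattice_lines"
    and u: "\<And>p. u p = a * real_of_int (fst p) + b * real_of_int (snd p) + c"
    and v: "\<And>p. v p = a' * real_of_int (fst p) + b' * real_of_int (snd p) + c'"
    and mem: "p1 \<in> l" "p2 \<in> l" "p3 \<in> l" "p4 \<in> l"
    and sgn: "u p1 > 0" "v p1 > 0" "u p2 < 0" "v p2 < 0" "u p3 > 0" "v p3 < 0" "u p4 < 0" "v p4 > 0"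
  shows False
proof -
  obtain \<xi> \<eta> :: real where \<xi>\<eta>: "\<forall>p\<in>l. \<forall>q\<in>l.
     real_of_int (fst p) - real_of_int (fst q) = \<xi> * (real_of_int (line_coord l p) - real_of_int (line_coord l q)) \<and>
     real_of_int (snd p) - real_of_int (snd q) = \<eta> * (real_of_int (line_coord l p) - real_of_int (line_coord l q))"
    using line_coord_param[OF l] by blast
  define \<tau> where "\<tau> p = real_of_int (line_coord l p)" for p
  define k k' where "k = a * \<xi> + b * \<eta>" and "k' = a' * \<xi> + b' * \<eta>"
  have U: "u p - u q = k * (\<tau> p - \<tau> q)" and V: "v p - v q = k' * (\<tau> p - \<tau> q)"
    if "p \<in> l" "q \<in> l" for p q
  proof -
    have "u p - u q = a * (real_of_int (fst p) - real_of_int (fst q)) + b * (real_of_int (snd p) - real_of_int (snd q))"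
      "v p - v q = a' * (real_of_int (fst p) - real_of_int (fst q)) + b' * (real_of_int (snd p) - real_of_int (snd q))"
      by (simp_all add: u v algebra_simps)
    then show "u p - u q = k * (\<tau> p - \<tau> q)" "v p - v q = k' * (\<tau> p - \<tau> q)"
      using bspec[OF bspec[OF \<xi>\<eta>], OF that] by (simp_all add: k_def k'_def \<tau>_def algebra_simps)
  qed
  have "0 < (u p1 - u p2) * (v p1 - v p2)" "0 < (u p3 - u p4) * (v p4 - v p3)"
    using sgn by (auto intro!: mult_pos_pos)
  then have "0 < (k * k') * (\<tau> p1 - \<tau> p2)\<^sup>2" "0 < (k * k') * - ((\<tau> p3 - \<tau> p4)\<^sup>2)"
    using mem by (simp_all add: U V power2_eq_square algebra_simps)
  then have "0 < k * k'" "k * k' < 0"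
    using zero_le_power2[of "\<tau> p1 - \<tau> p2"] zero_le_power2[of "\<tau> p3 - \<tau> p4"]
    by (auto simp: zero_less_mult_iff mult_less_0_iff)
  then show False by simp
qed

section \<open>Medians and a ham sandwich line\<close>

definition median :: "'a set \<Rightarrow> ('a \<Rightarrow> real) \<Rightarrow> real" where
  "median A f = Min {f a | a. a \<in> A \<and> card A \<le> 2 * card {p \<in> A. f p \<le> f a}}"

text \<open>The maximum of \<open>f\<close> always qualifies, so the minimum in
  \<open>median\<close> exists. The largest value below the median does not qualify, which gives the
  strict bound.\<close>

lemma
  assumes "finite A" "A \<noteq> {}"
  shows median_in_image: "median A f \<in> f ` A"
    and card_le_median: "card A \<le> 2 * card {p \<in> A. f p \<le> median A f}"
    and card_less_median_strict: "2 * card {p \<in> A. f p < median A f} < card A"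
proof -
  let ?S = "{f a | a. a \<in> A \<and> card A \<le> 2 * card {p \<in> A. f p \<le> f a}}"
  have S: "?S \<subseteq> f ` A" by blast
  have fin: "finite ?S" by (rule finite_subset[OF S]) (use assms in simp)
  have "Max (f ` A) \<in> f ` A" using assms by simp
  then obtain a where a: "a \<in> A" "f a = Max (f ` A)" by auto
  have "{p \<in> A. f p \<le> f a} = A" using assms a by auto
  then have "a \<in> A \<and> card A \<le> 2 * card {p \<in> A. f p \<le> f a}" using a(1) by simp
  then have "f a \<in> ?S" by blast
  then have med: "median A f \<in> ?S"
    unfolding median_def using Min_in[OF fin] by blast
  then show "median A f \<in> f ` A" "card A \<le> 2 * card {p \<in> A. f p \<le> median A f}"
    by auto
  show "2 * card {p \<in> A. f p < median A f} < card A"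
  proof (cases "{p \<in> A. f p < median A f} = {}")
    case True
    then show ?thesis using assms unfolding True by (simp add: card_gt_0_iff)
  next
    case False
    let ?L = "{p \<in> A. f p < median A f}"
    have "Max (f ` ?L) \<in> f ` ?L" using False assms by simp
    then obtain b where b: "b \<in> ?L" "f b = Max (f ` ?L)" by auto
    have "{p \<in> A. f p \<le> f b} = ?L"
      using b assms by (auto intro!: Max_ge)
    moreover have "f b \<notin> ?S"
      using Min_le[OF fin, of "f b"] b(1) unfolding median_def by auto
    ultimately show ?thesis using b(1) by fastforce
  qed
qed

lemma card_greater_median:
  assumes "finite A" "A \<noteq> {}"
  shows "2 * card {p \<in> A. f p > median A f} \<le> card A"
proof -
  have "{p \<in> A. f p > median A f} = A - {p \<in> A. f p \<le> median A f}" by auto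
  moreover have "card (A - {p \<in> A. f p \<le> median A f}) = card A - card {p \<in> A. f p \<le> median A f}"
    using assms by (intro card_Diff_subset) auto
  ultimately show ?thesis using card_le_median[OF assms, of f] by simp
qed

text \<open>Otherwise the elements with \<open>g\<close> at most its median, at least half of
  \<open>A\<close>, would all have \<open>f\<close> strictly below its median, where fewer than half
  lie.\<close>

lemma median_mono:
  assumes "finite A" "A \<noteq> {}" and le: "\<And>p. p \<in> A \<Longrightarrow> f p \<le> g p + e"
  shows "median A f \<le> median A g + e"
proof (rule ccontr)
  assume "\<not> ?thesis"
  then have "{p \<in> A. g p \<le> median A g} \<subseteq> {p \<in> A. f p < median A f}"
    using le by force
  then have "card {p \<in> A. g p \<le> median A g} \<le> card {p \<in> A. f p < median A f}"
    using assms(1) by (intro card_mono) auto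
  then show False
    using card_le_median[OF assms(1,2), of g] card_less_median_strict[OF assms(1,2), of f] by simp
qed

lemma continuous_median:
  assumes "finite A" "A \<noteq> {}"
  shows "continuous_on UNIV (\<lambda>s. median A (\<lambda>p. y p - s * x p))"
proof -
  define K where "K = Max ((\<lambda>p. \<bar>x p\<bar>) ` A)"
  have K: "\<bar>x p\<bar> \<le> K" if "p \<in> A" for p
    unfolding K_def using that assms by auto
  have K0: "0 \<le> K" using K assms(2) by (meson abs_ge_zero all_not_in_conv order_trans)
  have le: "median A (\<lambda>p. y p - s * x p) \<le> median A (\<lambda>p. y p - s' * x p) + K * \<bar>s - s'\<bar>" for s s'
  proof (rule median_mono[OF assms])
    fix p assume "p \<in> A"
    have "(s' - s) * x p \<le> \<bar>s - s'\<bar> * \<bar>x p\<bar>"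
      by (metis abs_ge_self abs_minus_commute abs_mult)
    also have "\<dots> \<le> \<bar>s - s'\<bar> * K" using K[OF \<open>p \<in> A\<close>] by (intro mult_left_mono) auto
    finally show "y p - s * x p \<le> y p - s' * x p + K * \<bar>s - s'\<bar>"
      by (simp add: algebra_simps)
  qed
  have "K-lipschitz_on UNIV (\<lambda>s. median A (\<lambda>p. y p - s * x p))"
  proof (rule lipschitz_onI[OF _ K0])
    fix s s' :: real
    show "dist (median A (\<lambda>p. y p - s * x p)) (median A (\<lambda>p. y p - s' * x p)) \<le> K * dist s s'"
      using le[of s s'] le[of s' s] by (auto simp: dist_real_def abs_minus_commute abs_le_iff)
  qed
  then show ?thesis by (rule lipschitz_on_continuous_on)
qed

text \<open>The median of \<open>y p - s * x p\<close> is the intercept of a line of slope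
  \<open>s\<close> that halves a set. As \<open>A\<close> and \<open>B\<close> lie on different
  sides of the axis, the order of their medians is reversed between very negative and very positive
  slopes, so by the intermediate value theorem the two agree for some slope.\<close>

lemma ham_sandwich_line:
  fixes x y :: "'a \<Rightarrow> real"
  assumes "finite A" "finite B" and neg: "\<And>p. p \<in> A \<Longrightarrow> x p < 0" and pos: "\<And>p. p \<in> B \<Longrightarrow> x p > 0"
  obtains s c where
    "\<And>D. D \<in> {A, B} \<Longrightarrow> 2 * card {p \<in> D. y p - s * x p < c} \<le> card D \<and>
       2 * card {p \<in> D. y p - s * x p > c} \<le> card D"
proof -
  have half: "2 * card {p \<in> D. y p - s * x p < median D (\<lambda>p. y p - s * x p)} \<le> card D \<and>
       2 * card {p \<in> D. y p - s * x p > median D (\<lambda>p. y p - s * x p)} \<le> card D"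
    if "finite D" "D \<noteq> {}" for D s
    using card_less_median_strict[OF that, of "\<lambda>p. y p - s * x p"]
      card_greater_median[OF that, of "\<lambda>p. y p - s * x p"] by simp
  consider "A = {}" "B = {}" | "A = {}" "B \<noteq> {}" | "B = {}" "A \<noteq> {}" | "A \<noteq> {}" "B \<noteq> {}" by blast
  then show ?thesis
  proof cases
    case 1
    then show ?thesis by (intro that[of 0 0]) auto
  next
    case 2
    then show ?thesis
      using half[OF assms(2), of 0] by (intro that[of 0 "median B (\<lambda>p. y p - 0 * x p)"]) auto
  next
    case 3
    then show ?thesis
      using half[OF assms(1), of 0] by (intro that[of 0 "median A (\<lambda>p. y p - 0 * x p)"]) auto
  next
    case 4
    define mA mB where "mA s = median A (\<lambda>p. y p - s * x p)"
      and "mB s = median B (\<lambda>p. y p - s * x p)" for s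
    \<comment> \<open>\<open>q (a, b)\<close> is the absolute slope of the line through
      \<open>a\<close> and \<open>b\<close>. At slope \<open>S\<close> no intercept from
      \<open>B\<close> exceeds one from \<open>A\<close>; at slope \<open>- S\<close> the opposite
      holds.\<close>
    define q where "q = (\<lambda>(a, b). \<bar>y b - y a\<bar> / (x b - x a))"
    define S where "S = Max (q ` (A \<times> B))"
    have S: "\<bar>y b - y a\<bar> \<le> S * (x b - x a)" if "a \<in> A" "b \<in> B" for a b
    proof -
      have "q (a, b) \<le> S"
        unfolding S_def using that assms by (intro Max_ge) auto
      moreover have "x b - x a > 0" using neg[OF that(1)] pos[OF that(2)] by simp
      ultimately show ?thesis by (simp add: q_def divide_le_eq)
    qed
    have S1: "mB S \<le> mA S"
    proof -
      obtain a b where "a \<in> A" "b \<in> B" "mA S = y a - S * x a" "mB S = y b - S * x b"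
        using median_in_image[OF assms(1) 4(1)] median_in_image[OF assms(2) 4(2)]
        unfolding mA_def mB_def by (metis (no_types, lifting) imageE)
      with S[of a b] show ?thesis by (simp add: algebra_simps)
    qed
    have S2: "mA (- S) \<le> mB (- S)"
    proof -
      obtain a b where "a \<in> A" "b \<in> B" "mA (- S) = y a - (- S) * x a" "mB (- S) = y b - (- S) * x b"
        using median_in_image[OF assms(1) 4(1)] median_in_image[OF assms(2) 4(2)]
        unfolding mA_def mB_def by (metis (no_types, lifting) imageE)
      with S[of a b] show ?thesis by (simp add: algebra_simps)
    qed
    have "S \<ge> 0"
    proof -
      obtain a b where "a \<in> A" "b \<in> B" using 4 by blast
      with S[of a b] neg[of a] pos[of b] show ?thesis
        by (smt (verit) mult_neg_pos)
    qed
    have cont: "continuous_on {- S..S} (\<lambda>s. mA s - mB s)"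
      unfolding mA_def mB_def
      by (intro continuous_on_diff continuous_on_subset[OF continuous_median] assms 4) auto
    obtain s where "mA s - mB s = 0"
      using IVT'[of "\<lambda>s. mA s - mB s" "- S" 0 S] cont S1 S2 \<open>S \<ge> 0\<close> by auto
    then show ?thesis
      using half[OF assms(1) 4(1), of s] half[OF assms(2) 4(2), of s]
      by (intro that[of s "mA s"]) (auto simp: mA_def mB_def)
  qed
qed

text \<open>A vertical line at the median leaves at most half of \<open>X\<close> on either side,
  and a ham sandwich line then halves both sides at once. The predicate \<open>(<) m\<close> holds
  to the right of \<open>m\<close>; points on the two lines belong to none of the four
  quadrants.\<close>

lemma quartering:
  fixes X :: "point set"
  assumes "finite X"
  shows "\<exists>m s c :: real. \<forall>P\<in>{(<) m, (>) m}. \<forall>Q\<in>{(<) c, (>) c}.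
     4 * card {p \<in> X. P (real_of_int (fst p)) \<and> Q (real_of_int (snd p) - s * (real_of_int (fst p) - m))} \<le> card X"
proof (cases "X = {}")
  case True
  then show ?thesis by auto
next
  case False
  define m where "m = median X (\<lambda>p. real_of_int (fst p))"
  define A B where "A = {p \<in> X. real_of_int (fst p) < m}" and "B = {p \<in> X. real_of_int (fst p) > m}"
  have AB: "2 * card A \<le> card X" "2 * card B \<le> card X"
    using card_less_median_strict[OF assms False, of "\<lambda>p. real_of_int (fst p)"]
      card_greater_median[OF assms False, of "\<lambda>p. real_of_int (fst p)"]
    by (auto simp: A_def B_def m_def)
  obtain s c where sc: "\<And>D. D \<in> {A, B} \<Longrightarrow>
      2 * card {p \<in> D. real_of_int (snd p) - s * (real_of_int (fst p) - m) < c} \<le> card D \<and>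
      2 * card {p \<in> D. real_of_int (snd p) - s * (real_of_int (fst p) - m) > c} \<le> card D"
    using ham_sandwich_line[of A B "\<lambda>p. real_of_int (fst p) - m" "\<lambda>p. real_of_int (snd p)"] assms
    by (auto simp: A_def B_def)
  have "4 * card {p \<in> X. P (real_of_int (fst p)) \<and> Q (real_of_int (snd p) - s * (real_of_int (fst p) - m))} \<le> card X"
    if "P \<in> {(<) m, (>) m}" "Q \<in> {(<) c, (>) c}" for P Q
  proof -
    define D where "D = {p \<in> X. P (real_of_int (fst p))}"
    have D: "D \<in> {A, B}" using that(1) unfolding D_def A_def B_def by blast
    have "{p \<in> X. P (real_of_int (fst p)) \<and> Q (real_of_int (snd p) - s * (real_of_int (fst p) - m))} =
        {p \<in> D. Q (real_of_int (snd p) - s * (real_of_int (fst p) - m))}"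
      unfolding D_def by blast
    moreover have "2 * card {p \<in> D. Q (real_of_int (snd p) - s * (real_of_int (fst p) - m))} \<le> card D"
      using sc[OF D] that(2) by blast
    moreover have "2 * card D \<le> card X" using D AB by blast
    ultimately show ?thesis by simp
  qed
  then show ?thesis by blast
qed

section \<open>Incidences between points and lines\<close>

text \<open>If some line of \<open>L\<close> has two points of \<open>Z\<close>, it contains all of
  \<open>Z\<close>, and every other line of \<open>L\<close> meets \<open>Z\<close> at most once.
  This controls the points on the two cutting lines of a quartering.\<close>

lemma sum_card_lines_on_affine_line:
  fixes a b c :: real
  assumes "finite X" "finite L" "L \<subseteq> lattice_lines" and ab: "a \<noteq> 0 \<or> b \<noteq> 0"
    and Z: "Z = {p \<in> X. a * real_of_int (fst p) + b * real_of_int (snd p) = c}"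
  shows "(\<Sum>l\<in>L. card (l \<inter> Z)) \<le> card L + card X"
proof -
  have fZ: "finite Z" using assms by simp
  have two: "\<exists>p q. p \<in> S \<and> q \<in> S \<and> p \<noteq> q" if "\<not> card S \<le> 1" "S \<subseteq> Z" for S
    using that card_le_Suc0_iff_eq[of S] finite_subset[OF that(2) fZ] by auto
  show ?thesis
  proof (cases "\<exists>l\<in>L. \<not> card (l \<inter> Z) \<le> 1")
    case False
    then have "(\<Sum>l\<in>L. card (l \<inter> Z)) \<le> (\<Sum>l\<in>L. 1)" by (intro sum_mono) auto
    then show ?thesis by simp
  next
    case True
    then obtain l where l: "l \<in> L" "\<not> card (l \<inter> Z) \<le> 1" by blast
    obtain p q where pq: "p \<in> l \<inter> Z" "q \<in> l \<inter> Z" "p \<noteq> q" using two[OF l(2)] by blast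
    have ll: "l \<in> lattice_lines" using l assms by blast
    have sub: "Z \<subseteq> l"
    proof
      fix r assume r: "r \<in> Z"
      define X Y dx dy where "X = real_of_int (fst r - fst p)" and "Y = real_of_int (snd r - snd p)"
        and "dx = real_of_int (fst q - fst p)" and "dy = real_of_int (snd q - snd p)"
      have 0: "a * X + b * Y = 0" "a * dx + b * dy = 0"
        using r pq by (auto simp: Z X_def Y_def dx_def dy_def algebra_simps)
      have "a * (X * dy - Y * dx) = (a * X + b * Y) * dy - (a * dx + b * dy) * Y"
        "b * (X * dy - Y * dx) = (a * dx + b * dy) * X - (a * X + b * Y) * dx"
        by (simp_all add: algebra_simps)
      then have "X * dy = Y * dx" using 0 ab by auto
      then have "(fst r - fst p) * (snd q - snd p) = (snd r - snd p) * (fst q - fst p)"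
        unfolding X_def Y_def dx_def dy_def of_int_mult[symmetric] of_int_eq_iff .
      then show "r \<in> l"
        using lattice_line_eq[OF ll _ _ pq(3)] pq by blast
    qed
    have "card (l' \<inter> Z) \<le> 1" if "l' \<in> L - {l}" for l'
    proof (rule ccontr)
      assume "\<not> card (l' \<inter> Z) \<le> 1"
      from two[OF this] obtain p q where "p \<in> l' \<inter> Z" "q \<in> l' \<inter> Z" "p \<noteq> q" by blast
      then have "l' = l"
        using sub that assms(3) ll by (intro lattice_lines_meet[of l' l p q]) auto
      with that show False by simp
    qed
    then have "(\<Sum>l\<in>L - {l}. card (l \<inter> Z)) \<le> (\<Sum>l\<in>L - {l}. 1)" by (intro sum_mono) auto
    also have "\<dots> \<le> card L" using assms(2) by (simp add: card_mono)
    finally have "(\<Sum>l\<in>L - {l}. card (l \<inter> Z)) \<le> card L" .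
    moreover have "card (l \<inter> Z) \<le> card X" using assms(1) by (intro card_mono) (auto simp: Z)
    ultimately show ?thesis
      using sum.remove[OF assms(2) l(1), of "\<lambda>l. card (l \<inter> Z)"] by simp
  qed
qed

text \<open>Two points determine a line, so the ordered pairs of distinct points on different lines
  are different elements of \<open>X \<times> X\<close>. With Cauchy--Schwarz this gives
  \<open>I\<^sup>2 \<le> ((card X)\<^sup>2 + I) * card L\<close>, a quadratic inequality for the
  number \<open>I\<close> of incidences.\<close>

lemma incidences_trivial_bound:
  assumes "finite X" "finite L" "L \<subseteq> lattice_lines"
  shows "(\<Sum>l\<in>L. real (card (l \<inter> X))) \<le> real (card L) + real (card X) * sqrt (real (card L))"
proof -
  define I where "I = (\<Sum>l\<in>L. real (card (l \<inter> X)))"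
  define D where "D l = {pq \<in> (l \<inter> X) \<times> (l \<inter> X). fst pq \<noteq> snd pq}" for l
  have cD: "real (card (D l)) = (real (card (l \<inter> X)))\<^sup>2 - real (card (l \<inter> X))" for l
  proof -
    have "D l = (l \<inter> X) \<times> (l \<inter> X) - (\<lambda>p. (p, p)) ` (l \<inter> X)"
      by (auto simp: D_def)
    moreover have "card ((l \<inter> X) \<times> (l \<inter> X) - (\<lambda>p. (p, p)) ` (l \<inter> X)) =
        card ((l \<inter> X) \<times> (l \<inter> X)) - card ((\<lambda>p. (p, p)) ` (l \<inter> X))"
      using assms(1) by (intro card_Diff_subset) auto
    moreover have "card ((\<lambda>p. (p, p)) ` (l \<inter> X)) = card (l \<inter> X)"
      by (rule card_image) (auto simp: inj_on_def)
    ultimately have "card (D l) = card (l \<inter> X) * card (l \<inter> X) - card (l \<inter> X)"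
      by (simp add: card_cartesian_product)
    then show ?thesis by (simp add: power2_eq_square of_nat_diff)
  qed
  have "(\<Sum>l\<in>L. card (D l)) = card (\<Union>l\<in>L. D l)"
  proof (rule card_UN_disjoint[symmetric, OF assms(2)])
    show "\<forall>i\<in>L. finite (D i)" using assms(1) by (auto simp: D_def)
    show "\<forall>i\<in>L. \<forall>j\<in>L. i \<noteq> j \<longrightarrow> D i \<inter> D j = {}"
    proof (intro ballI impI equals0I)
      fix i j pq assume ij: "i \<in> L" "j \<in> L" "i \<noteq> j" and pq: "pq \<in> D i \<inter> D j"
      have "i = j"
        using ij pq assms(3) by (intro lattice_lines_meet[of i j "fst pq" "snd pq"]) (auto simp: D_def)
      with ij show False by simp
    qed
  qed
  also have "\<dots> \<le> card (X \<times> X)"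
    using assms(1) by (intro card_mono) (auto simp: D_def)
  finally have "real (\<Sum>l\<in>L. card (D l)) \<le> real (card (X \<times> X))" by (rule of_nat_mono)
  then have sq: "(\<Sum>l\<in>L. (real (card (l \<inter> X)))\<^sup>2) \<le> (real (card X))\<^sup>2 + I"
    by (simp add: cD sum_subtractf I_def card_cartesian_product power2_eq_square)
  have "I\<^sup>2 \<le> (\<Sum>l\<in>L. (real (card (l \<inter> X)))\<^sup>2) * (\<Sum>l\<in>L. 1\<^sup>2)"
    using Cauchy_Schwarz_ineq_sum[of "\<lambda>l. real (card (l \<inter> X))" "\<lambda>l. 1" L] by (simp add: I_def)
  also have "\<dots> \<le> ((real (card X))\<^sup>2 + I) * real (card L)"
    using sq by (simp add: mult_right_mono)
  finally have I2: "I\<^sup>2 \<le> ((real (card X))\<^sup>2 + I) * real (card L)" .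
  define R where "R = real (card X) * sqrt (real (card L))"
  have R2: "R * R = (real (card X))\<^sup>2 * real (card L)"
    by (simp add: R_def power2_eq_square)
  have R0: "0 \<le> R" by (simp add: R_def)
  have "I \<le> real (card L) + R"
  proof (rule ccontr)
    assume "\<not> ?thesis"
    then have *: "R < I - real (card L)" "R < I" by auto
    have "R * R < (I - real (card L)) * I"
      using * R0 by (intro mult_strict_mono) auto
    then show False using I2 R2 by (simp add: power2_eq_square algebra_simps)
  qed
  then show ?thesis by (simp add: I_def R_def)
qed

lemma sum_sqrt_le:
  fixes f :: "'a \<Rightarrow> real"
  assumes "\<And>i. i \<in> I \<Longrightarrow> f i \<ge> 0"
  shows "(\<Sum>i\<in>I. sqrt (f i)) \<le> sqrt (real (card I) * (\<Sum>i\<in>I. f i))"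
proof -
  have "(\<Sum>i\<in>I. sqrt (f i) * 1)\<^sup>2 \<le> (\<Sum>i\<in>I. (sqrt (f i))\<^sup>2) * (\<Sum>i\<in>I. 1\<^sup>2)"
    by (rule Cauchy_Schwarz_ineq_sum)
  then have "(\<Sum>i\<in>I. sqrt (f i))\<^sup>2 \<le> real (card I) * (\<Sum>i\<in>I. f i)"
    using assms by (simp add: mult.commute)
  then show ?thesis by (rule real_le_rsqrt)
qed

text \<open>A weak form of the Szemeredi--Trotter bound: the factor in front of the leading term of the
  Cauchy--Schwarz bound can be made arbitrarily small. A line meets at most three of the four
  quadrants of a quartering, so each round of quartering gains a factor of \<open>sqrt 3 / 2\<close>.\<close>

lemma incidences_bound:
  "\<exists>A C. A \<ge> 0 \<and> C \<ge> 0 \<and> (\<forall>X L. finite X \<longrightarrow> finite L \<longrightarrow> L \<subseteq> lattice_lines \<longrightarrow>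
     (\<Sum>l\<in>L. real (card (l \<inter> X))) \<le>
       A * real (card L) + (sqrt 3 / 2) ^ j * real (card X) * sqrt (real (card L)) + C * real (card X))"
proof (induction j)
  case 0
  show ?case
    using incidences_trivial_bound by (intro exI[of _ 1] exI[of _ 0]) simp
next
  case (Suc j)
  define B where "B = (sqrt 3 / 2 :: real) ^ j"
  from Suc obtain A C where AC: "A \<ge> 0" "C \<ge> 0" and IH: "\<And>X L. finite X \<Longrightarrow> finite L \<Longrightarrow> L \<subseteq> lattice_lines \<Longrightarrow>
     (\<Sum>l\<in>L. real (card (l \<inter> X))) \<le> A * real (card L) + B * real (card X) * sqrt (real (card L)) + C * real (card X)"
    unfolding B_def by blast
  have B0: "B \<ge> 0" by (simp add: B_def)
  \<comment> \<open>The factor 3 arises because each line is counted for at most three quadrants;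
    both summands 2 account for the points on the two cutting lines.\<close>
  have "(\<Sum>l\<in>L. real (card (l \<inter> X))) \<le>
      (3 * A + 2) * real (card L) + (sqrt 3 / 2) ^ Suc j * real (card X) * sqrt (real (card L)) + (C + 2) * real (card X)"
    if X: "finite X" and L: "finite L" "L \<subseteq> lattice_lines" for X L
  proof -
    obtain m s c :: real where msc: "\<forall>P\<in>{(<) m, (>) m}. \<forall>Q\<in>{(<) c, (>) c}.
       4 * card {p \<in> X. P (real_of_int (fst p)) \<and> Q (real_of_int (snd p) - s * (real_of_int (fst p) - m))} \<le> card X"
      using quartering[OF X] by blast
    define u v where "u p = 1 * real_of_int (fst p) + 0 * real_of_int (snd p) + (- m)"
      and "v p = (- s) * real_of_int (fst p) + 1 * real_of_int (snd p) + (s * m - c)" for p :: point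
    define G where "G w z = (if w then z > (0::real) else z < 0)" for w z
    define Xq where "Xq w = {p \<in> X. G (fst w) (u p) \<and> G (snd w) (v p)}" for w
    define Lq where "Lq w = {l \<in> L. l \<inter> Xq w \<noteq> {}}" for w
    define Zu Zv where "Zu = {p \<in> X. 1 * real_of_int (fst p) + 0 * real_of_int (snd p) = m}"
      and "Zv = {p \<in> X. (- s) * real_of_int (fst p) + 1 * real_of_int (snd p) = c - s * m}"
    have fq: "finite (Xq w)" "finite (Lq w)" "Lq w \<subseteq> lattice_lines" "Xq w \<subseteq> X" "Lq w \<subseteq> L" for w
      using X L by (auto simp: Xq_def Lq_def)
    have Xq4: "real (card (Xq w)) \<le> real (card X) / 4" for w
    proof -
      have "Xq w = {p \<in> X. (if fst w then (<) m else (>) m) (real_of_int (fst p)) \<and>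
          (if snd w then (<) c else (>) c) (real_of_int (snd p) - s * (real_of_int (fst p) - m))}"
        unfolding Xq_def G_def u_def v_def by (auto simp: algebra_simps)
      then have "4 * card (Xq w) \<le> card X"
        using bspec[OF bspec[OF msc], of "if fst w then (<) m else (>) m" "if snd w then (<) c else (>) c"] by simp
      then show ?thesis by simp
    qed
    have Xqsum: "(\<Sum>w\<in>UNIV. real (card (Xq w))) \<le> real (card X)"
      using sum_mono[of UNIV "\<lambda>w. real (card (Xq w))" "\<lambda>w. real (card X) / 4"] Xq4
      by (simp add: card_UNIV_bool UNIV_Times_UNIV[symmetric] card_cartesian_product del: UNIV_Times_UNIV)
    have three: "(\<Sum>w\<in>UNIV. real (card (Lq w))) \<le> 3 * real (card L)"
    proof -
      have miss: "\<exists>w. l \<notin> Lq w" if "l \<in> L" for l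
      proof (rule ccontr)
        assume "\<not> ?thesis"
        then have "l \<in> Lq (True, True)" "l \<in> Lq (False, False)" "l \<in> Lq (True, False)" "l \<in> Lq (False, True)"
          by blast+
        then obtain p1 p2 p3 p4 where "p1 \<in> l" "p2 \<in> l" "p3 \<in> l" "p4 \<in> l"
          "u p1 > 0" "v p1 > 0" "u p2 < 0" "v p2 < 0" "u p3 > 0" "v p3 < 0" "u p4 < 0" "v p4 > 0"
          by (auto simp: Lq_def Xq_def G_def)
        moreover have "l \<in> lattice_lines" using that L by blast
        ultimately show False
          using line_misses_quadrant[of l u 1 0 "- m" v "- s" 1 "s * m - c" p1 p2 p3 p4]
          by (simp add: u_def v_def)
      qed
      have U: "(UNIV :: (bool \<times> bool) set) = {(True, True), (True, False), (False, True), (False, False)}"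
        by auto
      have "(\<Sum>w\<in>UNIV. real (card (Lq w))) = (\<Sum>w\<in>UNIV. \<Sum>l\<in>L. if l \<in> Lq w then 1 else 0)"
        using L(1) fq(5) by (intro sum.cong refl) (simp add: sum.If_cases Int_absorb1)
      also have "\<dots> = (\<Sum>l\<in>L. \<Sum>w\<in>UNIV. if l \<in> Lq w then 1 else 0)"
        by (rule sum.swap)
      also have "\<dots> \<le> (\<Sum>l\<in>L. 3)"
      proof (rule sum_mono)
        fix l assume "l \<in> L"
        then obtain w where "l \<notin> Lq w" using miss by blast
        then show "(\<Sum>w\<in>UNIV. if l \<in> Lq w then 1 else 0) \<le> (3::real)"
          unfolding U by (cases w; cases "fst w"; cases "snd w") auto
      qed
      finally show ?thesis by simp
    qed
    have split: "real (card (l \<inter> X)) \<le> (\<Sum>w\<in>UNIV. real (card (l \<inter> Xq w))) + real (card (l \<inter> Zu)) + real (card (l \<inter> Zv))" for l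
    proof -
      have "l \<inter> X \<subseteq> (\<Union>w\<in>UNIV. l \<inter> Xq w) \<union> (l \<inter> Zu) \<union> (l \<inter> Zv)"
      proof
        fix p assume p: "p \<in> l \<inter> X"
        show "p \<in> (\<Union>w\<in>UNIV. l \<inter> Xq w) \<union> (l \<inter> Zu) \<union> (l \<inter> Zv)"
        proof (cases "u p = 0 \<or> v p = 0")
          case True
          then show ?thesis using p by (auto simp: u_def v_def Zu_def Zv_def)
        next
          case False
          then have "p \<in> Xq (u p > 0, v p > 0)" using p by (auto simp: Xq_def G_def)
          then show ?thesis using p by blast
        qed
      qed
      then have "card (l \<inter> X) \<le> card ((\<Union>w\<in>UNIV. l \<inter> Xq w) \<union> (l \<inter> Zu) \<union> (l \<inter> Zv))"
        using X by (intro card_mono) (auto simp: Xq_def Zu_def Zv_def)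
      also have "\<dots> \<le> card (\<Union>w\<in>UNIV. l \<inter> Xq w) + card (l \<inter> Zu) + card (l \<inter> Zv)"
        by (meson add_le_mono card_Un_le order_refl order_trans)
      also have "card (\<Union>w\<in>UNIV. l \<inter> Xq w) \<le> (\<Sum>w\<in>UNIV. card (l \<inter> Xq w))"
        by (rule card_UN_le) simp
      finally have "card (l \<inter> X) \<le> (\<Sum>w\<in>UNIV. card (l \<inter> Xq w)) + card (l \<inter> Zu) + card (l \<inter> Zv)"
        by simp
      then have "real (card (l \<inter> X)) \<le> real ((\<Sum>w\<in>UNIV. card (l \<inter> Xq w)) + card (l \<inter> Zu) + card (l \<inter> Zv))"
        by (rule of_nat_mono)
      then show ?thesis by simp
    qed
    have Z: "(\<Sum>l\<in>L. real (card (l \<inter> Zu))) \<le> real (card L) + real (card X)"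
      "(\<Sum>l\<in>L. real (card (l \<inter> Zv))) \<le> real (card L) + real (card X)"
      using sum_card_lines_on_affine_line[OF X L, of 1 0 Zu m]
        sum_card_lines_on_affine_line[OF X L, of "- s" 1 Zv "c - s * m"]
      unfolding of_nat_sum[symmetric] of_nat_add[symmetric] of_nat_le_iff by (simp_all add: Zu_def Zv_def)
    have q: "(\<Sum>l\<in>L. real (card (l \<inter> Xq w))) \<le>
        A * real (card (Lq w)) + B * (real (card X) / 4) * sqrt (real (card (Lq w))) + C * real (card (Xq w))" for w
    proof -
      have "(\<Sum>l\<in>L. real (card (l \<inter> Xq w))) = (\<Sum>l\<in>Lq w. real (card (l \<inter> Xq w)))"
        using L by (intro sum.mono_neutral_right) (auto simp: Lq_def)
      also have "\<dots> \<le> A * real (card (Lq w)) + B * real (card (Xq w)) * sqrt (real (card (Lq w))) + C * real (card (Xq w))"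
        by (rule IH[OF fq(1-3)])
      also have "B * real (card (Xq w)) * sqrt (real (card (Lq w))) \<le> B * (real (card X) / 4) * sqrt (real (card (Lq w)))"
        using B0 Xq4 by (intro mult_right_mono mult_left_mono) auto
      finally show ?thesis by simp
    qed
    \<comment> \<open>Source of the gain: each quadrant holds at most a quarter of the points, and
      \<open>2 * sqrt 3 / 4 = sqrt 3 / 2\<close>.\<close>
    have sq: "(\<Sum>w\<in>UNIV. sqrt (real (card (Lq w)))) \<le> 2 * sqrt 3 * sqrt (real (card L))"
    proof -
      have "(\<Sum>w\<in>UNIV. sqrt (real (card (Lq w)))) \<le> sqrt (real (card (UNIV :: (bool \<times> bool) set)) * (\<Sum>w\<in>UNIV. real (card (Lq w))))"
        by (rule sum_sqrt_le) simp
      also have "real (card (UNIV :: (bool \<times> bool) set)) = 4"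
        by (simp add: card_UNIV_bool UNIV_Times_UNIV[symmetric] card_cartesian_product del: UNIV_Times_UNIV)
      also have "sqrt (4 * (\<Sum>w\<in>UNIV. real (card (Lq w)))) \<le> sqrt (2\<^sup>2 * (3 * real (card L)))"
        using three by simp
      also have "\<dots> = 2 * sqrt 3 * sqrt (real (card L))"
        by (simp only: real_sqrt_mult real_sqrt_power[symmetric]) simp
      finally show ?thesis .
    qed
    have "(\<Sum>l\<in>L. real (card (l \<inter> X))) \<le>
        (\<Sum>l\<in>L. (\<Sum>w\<in>UNIV. real (card (l \<inter> Xq w))) + real (card (l \<inter> Zu)) + real (card (l \<inter> Zv)))"
      by (rule sum_mono) (rule split)
    also have "\<dots> = (\<Sum>w\<in>UNIV. \<Sum>l\<in>L. real (card (l \<inter> Xq w))) + (\<Sum>l\<in>L. real (card (l \<inter> Zu))) + (\<Sum>l\<in>L. real (card (l \<inter> Zv)))"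
      by (simp add: sum.distrib sum.swap[of _ L UNIV])
    also have "\<dots> \<le> (\<Sum>w\<in>UNIV. A * real (card (Lq w)) + B * (real (card X) / 4) * sqrt (real (card (Lq w))) + C * real (card (Xq w)))
        + (real (card L) + real (card X)) + (real (card L) + real (card X))"
      using Z by (intro add_mono sum_mono q)
    also have "\<dots> = A * (\<Sum>w\<in>UNIV. real (card (Lq w))) + B * (real (card X) / 4) * (\<Sum>w\<in>UNIV. sqrt (real (card (Lq w))))
        + C * (\<Sum>w\<in>UNIV. real (card (Xq w))) + 2 * real (card L) + 2 * real (card X)"
      by (simp add: sum.distrib sum_distrib_left)
    also have "\<dots> \<le> A * (3 * real (card L)) + B * (real (card X) / 4) * (2 * sqrt 3 * sqrt (real (card L)))
        + C * real (card X) + 2 * real (card L) + 2 * real (card X)"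
      using three sq Xqsum AC B0 by (intro add_mono mult_left_mono) auto
    also have "\<dots> = (3 * A + 2) * real (card L) + (sqrt 3 / 2) ^ Suc j * real (card X) * sqrt (real (card L)) + (C + 2) * real (card X)"
      by (simp add: B_def algebra_simps)
    finally show ?thesis .
  qed
  then show ?case
    using AC by (intro exI[of _ "3 * A + 2"] exI[of _ "C + 2"]) auto
qed

section \<open>Lines that contain many points of a set\<close>

text \<open>A line with two points in \<open>X\<close> is determined by its trace on
  \<open>X\<close>, and there are finitely many traces.\<close>

lemma finite_rich_lines:
  assumes "finite X" "w > 1"
  shows "finite {l \<in> lattice_lines. w \<le> real (card (l \<inter> X))}"
proof (rule inj_on_finite[of "\<lambda>l. l \<inter> X" _ "Pow X"])
  show "inj_on (\<lambda>l. l \<inter> X) {l \<in> lattice_lines. w \<le> real (card (l \<inter> X))}"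
  proof (rule inj_onI)
    fix l l' assume l: "l \<in> {l \<in> lattice_lines. w \<le> real (card (l \<inter> X))}"
      "l' \<in> {l \<in> lattice_lines. w \<le> real (card (l \<inter> X))}" and eq: "l \<inter> X = l' \<inter> X"
    have "\<not> card (l \<inter> X) \<le> Suc 0" using l assms(2) by auto
    then obtain p q where "p \<in> l \<inter> X" "q \<in> l \<inter> X" "p \<noteq> q"
      using card_le_Suc0_iff_eq[of "l \<inter> X"] assms(1) by auto
    then show "l = l'" using l eq by (intro lattice_lines_meet[of l l' p q]) auto
  qed
qed (use assms in auto)

text \<open>If \<open>I\<close> is the number of incidences of the rich lines, there are at most
  \<open>I / (\<epsilon> * n)\<close> such lines. Inserting this into
  \<open>incidences_bound\<close> with at most \<open>n\<^sup>2\<close> points leaves an inequality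
  for \<open>I\<close> alone, which fails above \<open>\<gamma> * n ^ 3\<close> once the leading
  factor is small.\<close>

theorem rich_line_incidences:
  fixes \<epsilon> \<gamma> :: real
  assumes "\<epsilon> > 0" "\<gamma> > 0"
  shows "\<forall>\<^sub>F n in sequentially. \<forall>X. finite X \<longrightarrow> card X \<le> n\<^sup>2 \<longrightarrow>
    (\<Sum>l | l \<in> lattice_lines \<and> \<epsilon> * real n \<le> real (card (l \<inter> X)). real (card (l \<inter> X))) \<le> \<gamma> * real n ^ 3"
proof -
  have "sqrt 3 / 2 < (1::real)" using real_sqrt_less_iff[of 3 4] by simp
  \<comment> \<open>With this bound the leading term, doubled after \<open>I / 2\<close> has been
    absorbed on the left, is at most \<open>I / 4\<close> when
    \<open>I > \<gamma> * n ^ 3\<close>.\<close>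
  then obtain j where j: "(sqrt 3 / 2 :: real) ^ j < sqrt (\<epsilon> * \<gamma>) / 8"
    using real_arch_pow_inv[of "sqrt (\<epsilon> * \<gamma>) / 8" "sqrt 3 / 2"] assms by auto
  define B where "B = (sqrt 3 / 2 :: real) ^ j"
  obtain A C where AC: "A \<ge> 0" "C \<ge> 0" and bd: "\<And>X L. finite X \<Longrightarrow> finite L \<Longrightarrow> L \<subseteq> lattice_lines \<Longrightarrow>
     (\<Sum>l\<in>L. real (card (l \<inter> X))) \<le> A * real (card L) + B * real (card X) * sqrt (real (card L)) + C * real (card X)"
    using incidences_bound[of j] unfolding B_def by blast
  have ev: "\<forall>\<^sub>F n in sequentially. x \<le> real n" for x
    using filterlim_real_sequentially unfolding filterlim_at_top by blast
  show ?thesis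
    using ev[of "2 / \<epsilon>"] ev[of "2 * A / \<epsilon>"] ev[of "8 * C / \<gamma>"] ev[of 1]
  proof eventually_elim
    case (elim n)
    show ?case
    proof (intro allI impI)
      fix X :: "point set" assume X: "finite X" "card X \<le> n\<^sup>2"
      define L where "L = {l \<in> lattice_lines. \<epsilon> * real n \<le> real (card (l \<inter> X))}"
      define I where "I = (\<Sum>l\<in>L. real (card (l \<inter> X)))"
      have n: "real n > 0" "\<epsilon> * real n \<ge> 2" "\<epsilon> * real n \<ge> 2 * A" "8 * C \<le> \<gamma> * real n"
        using elim assms by (auto simp: field_simps)
      have fin: "finite L" unfolding L_def using X n by (intro finite_rich_lines) auto
      have Lsub: "L \<subseteq> lattice_lines" by (auto simp: L_def)
      have LI: "real (card L) * (\<epsilon> * real n) \<le> I"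
        using sum_mono[of L "\<lambda>_. \<epsilon> * real n" "\<lambda>l. real (card (l \<inter> X))"] by (simp add: I_def L_def)
      have I0: "0 \<le> I" by (auto simp: I_def intro!: sum_nonneg)
      have X2: "real (card X) \<le> real n ^ 2" using X(2) by (metis of_nat_le_iff of_nat_power)
      have "I \<le> A * real (card L) + B * real (card X) * sqrt (real (card L)) + C * real (card X)"
        unfolding I_def by (rule bd[OF X(1) fin Lsub])
      also have "\<dots> \<le> I / 2 + B * real n ^ 2 * sqrt (I / (\<epsilon> * real n)) + C * real n ^ 2"
      proof (intro add_mono mult_mono mult_left_mono X2)
        have "2 * A * real (card L) \<le> \<epsilon> * real n * real (card L)"
          using n(3) by (intro mult_right_mono) auto
        also have "\<dots> \<le> I" using LI by (simp add: mult_ac)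
        finally show "A * real (card L) \<le> I / 2" by simp
        show "sqrt (real (card L)) \<le> sqrt (I / (\<epsilon> * real n))"
          using LI n assms by (intro real_sqrt_le_mono) (simp add: pos_le_divide_eq)
      qed (use AC in \<open>auto simp: B_def\<close>)
      finally have 1: "I \<le> 2 * B * real n ^ 2 * sqrt (I / (\<epsilon> * real n)) + 2 * C * real n ^ 2" by simp
      have "I \<le> \<gamma> * real n ^ 3"
      proof (rule ccontr)
        assume "\<not> ?thesis"
        then have big: "\<gamma> * real n ^ 3 < I" by simp
        have "2 * C * real n ^ 2 \<le> \<gamma> * real n / 4 * real n ^ 2"
          using n(4) by (intro mult_right_mono) auto
        also have "\<dots> = (\<gamma> * real n ^ 3) / 4" by (simp add: power2_eq_square power3_eq_cube)
        also have "\<dots> \<le> I / 4" using big by simp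
        finally have C: "2 * C * real n ^ 2 \<le> I / 4" .
        have "2 * B * real n ^ 2 * sqrt (I / (\<epsilon> * real n)) \<le> sqrt (\<epsilon> * \<gamma>) / 4 * real n ^ 2 * sqrt (I / (\<epsilon> * real n))"
          using j I0 assms n by (intro mult_right_mono) (auto simp: B_def)
        also have "\<dots> = sqrt ((\<gamma> * real n ^ 3) * I) / 4"
        proof -
          have "sqrt (\<epsilon> * \<gamma>) * real n ^ 2 * sqrt (I / (\<epsilon> * real n)) = sqrt (\<epsilon> * \<gamma>) * sqrt ((real n ^ 2)\<^sup>2) * sqrt (I / (\<epsilon> * real n))"
            by (simp only: real_sqrt_abs abs_power2)
          also have "\<dots> = sqrt (\<epsilon> * \<gamma> * (real n ^ 2)\<^sup>2 * (I / (\<epsilon> * real n)))"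
            by (simp only: real_sqrt_mult)
          also have "\<epsilon> * \<gamma> * (real n ^ 2)\<^sup>2 * (I / (\<epsilon> * real n)) = (\<gamma> * real n ^ 3) * I"
            using assms n by (simp add: field_simps power2_eq_square power3_eq_cube)
          finally show ?thesis by simp
        qed
        also have "\<dots> \<le> sqrt (I * I) / 4"
          using big I0 by (intro divide_right_mono real_sqrt_le_mono mult_right_mono) auto
        also have "\<dots> = I / 4" using I0 by simp
        finally have "I \<le> I / 2" using 1 C by simp
        moreover have "I > 0" using big assms(2) n(1) by (smt (verit) mult_pos_pos zero_less_power)
        ultimately show False by simp
      qed
      then show "(\<Sum>l | l \<in> lattice_lines \<and> \<epsilon> * real n \<le> real (card (l \<inter> X)). real (card (l \<inter> X))) \<le> \<gamma> * real n ^ 3"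
        by (simp add: I_def L_def)
    qed
  qed
qed

section \<open>Cells of a line\<close>

text \<open>The component of \<open>f\<close> after the removal of \<open>Q\<close> from the line,
  in the order given by \<open>line_coord\<close>. It is empty for \<open>f\<close> in
  \<open>Q \<inter> l\<close>.\<close>

definition line_cell :: "point set \<Rightarrow> point set \<Rightarrow> point \<Rightarrow> point set" where
  "line_cell Q l f = {r \<in> l. \<forall>q\<in>Q \<inter> l. \<not> (min (line_coord l r) (line_coord l f) \<le> line_coord l q \<and>
     line_coord l q \<le> max (line_coord l r) (line_coord l f))}"

lemma line_cell_subset: "line_cell Q l f \<subseteq> l"
  by (auto simp: line_cell_def)

lemma line_cell_disjoint: "line_cell Q l f \<inter> Q = {}"
proof (rule equals0I)
  fix r assume "r \<in> line_cell Q l f \<inter> Q"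
  then have "r \<in> Q \<inter> l" "\<forall>q\<in>Q \<inter> l. \<not> (min (line_coord l r) (line_coord l f) \<le> line_coord l q \<and>
     line_coord l q \<le> max (line_coord l r) (line_coord l f))"
    by (simp_all add: line_cell_def)
  then show False by (meson max.cobounded1 min.cobounded1)
qed

lemma in_line_cell_self:
  assumes "l \<in> lattice_lines" "f \<in> l" "f \<notin> Q"
  shows "f \<in> line_cell Q l f"
  using assms inj_onD[OF inj_on_line_coord[OF assms(1)], of _ f] by (force simp: line_cell_def)

lemma line_cell_convex:
  assumes "x \<in> line_cell Q l f" "y \<in> line_cell Q l f" "z \<in> l"
    "line_coord l x \<le> line_coord l z" "line_coord l z \<le> line_coord l y"
  shows "z \<in> line_cell Q l f"
  using assms unfolding line_cell_def by (smt (verit) mem_Collect_eq)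

text \<open>A point between \<open>r\<close> and \<open>f\<close> lies between \<open>r\<close> and
  \<open>f'\<close>, between \<open>f'\<close> and \<open>x\<close>, or between \<open>x\<close> and
  \<open>f\<close>. For \<open>Q = Q'\<close> it follows that cells of a line with a common point
  coincide.\<close>

lemma line_cell_mono:
  assumes "Q \<subseteq> Q'" "x \<in> line_cell Q' l f'" "x \<in> line_cell Q l f"
  shows "line_cell Q' l f' \<subseteq> line_cell Q l f"
proof
  fix r assume r: "r \<in> line_cell Q' l f'"
  have "\<not> (min (line_coord l r) (line_coord l f) \<le> line_coord l q \<and>
     line_coord l q \<le> max (line_coord l r) (line_coord l f))" if q: "q \<in> Q" "q \<in> l" for q
  proof -
    have "q \<in> Q'" using q assms(1) by blast
    then have "\<not> (min (line_coord l r) (line_coord l f') \<le> line_coord l q \<and>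
         line_coord l q \<le> max (line_coord l r) (line_coord l f'))"
      "\<not> (min (line_coord l x) (line_coord l f') \<le> line_coord l q \<and>
         line_coord l q \<le> max (line_coord l x) (line_coord l f'))"
      "\<not> (min (line_coord l x) (line_coord l f) \<le> line_coord l q \<and>
         line_coord l q \<le> max (line_coord l x) (line_coord l f))"
      using r assms(2,3) q by (auto simp: line_cell_def)
    then show ?thesis by linarith
  qed
  with r show "r \<in> line_cell Q l f" by (auto simp: line_cell_def)
qed

text \<open>The point \<open>f\<close> must be unclaimed: a full component is no threat, since Maker
  cannot add to it. The line is kept with the cell because the coordinate depends on it.\<close>

definition heavy_cells :: "real \<Rightarrow> point set \<Rightarrow> point set \<Rightarrow> (point set \<times> point set) set" where
  "heavy_cells w P Q = {(l, J). l \<in> lattice_lines \<and> (\<exists>f\<in>l - (P \<union> Q). J = line_cell Q l f) \<and>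
     w \<le> real (card (J \<inter> P))}"

lemma heavy_cellsD:
  assumes "e \<in> heavy_cells w P Q"
  shows "fst e \<in> lattice_lines" "snd e \<subseteq> fst e" "snd e \<inter> Q = {}" "w \<le> real (card (snd e \<inter> P))"
    "\<exists>f\<in>fst e - (P \<union> Q). snd e = line_cell Q (fst e) f"
proof -
  obtain l f where e: "e = (l, line_cell Q l f)" and "l \<in> lattice_lines" "f \<in> l - (P \<union> Q)"
    "w \<le> real (card (line_cell Q l f \<inter> P))"
    using assms unfolding heavy_cells_def by blast
  then show "fst e \<in> lattice_lines" "snd e \<subseteq> fst e" "snd e \<inter> Q = {}" "w \<le> real (card (snd e \<inter> P))"
    "\<exists>f\<in>fst e - (P \<union> Q). snd e = line_cell Q (fst e) f"
    using line_cell_subset[of Q l f] line_cell_disjoint[of Q l f] unfolding e fst_conv snd_conv by blast+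
qed

lemma heavy_cells_antimono: "w \<le> w' \<Longrightarrow> heavy_cells w' P Q \<subseteq> heavy_cells w P Q"
  by (auto simp: heavy_cells_def)

text \<open>Cells of one line are disjoint unless equal, and two different lines share at most one
  point.\<close>

lemma heavy_cells_meet:
  assumes "e \<in> heavy_cells w P Q" "e' \<in> heavy_cells w P Q" "e \<noteq> e'"
    "p \<in> snd e \<inter> snd e'" "q \<in> snd e \<inter> snd e'"
  shows "p = q"
proof (cases "fst e = fst e'")
  case True
  obtain f f' where e: "snd e = line_cell Q (fst e) f" "snd e' = line_cell Q (fst e) f'"
    using heavy_cellsD(5)[OF assms(1)] heavy_cellsD(5)[OF assms(2)] True by auto
  have "snd e = snd e'"
    unfolding e using assms(4)[unfolded e] line_cell_mono[OF order_refl] by (intro equalityI) blast+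
  with assms(3) True show ?thesis by (simp add: prod_eq_iff)
next
  case False
  with heavy_cellsD(1,2)[OF assms(1)] heavy_cellsD(1,2)[OF assms(2)] lattice_lines_meet[of "fst e" "fst e'" p q]
    assms(4,5)
  show ?thesis by blast
qed

lemma card_le_1I: "(\<And>p q. p \<in> A \<Longrightarrow> q \<in> A \<Longrightarrow> p = q) \<Longrightarrow> card A \<le> 1"
  by (cases "finite A") (auto simp: card_le_Suc0_iff_eq)

lemma finite_heavy_cells:
  assumes "finite P" "w > 1"
  shows "finite (heavy_cells w P Q)"
proof (rule inj_on_finite[of "\<lambda>e. snd e \<inter> P" _ "Pow P"])
  show "inj_on (\<lambda>e. snd e \<inter> P) (heavy_cells w P Q)"
  proof (rule inj_onI, rule ccontr)
    fix e e' assume e: "e \<in> heavy_cells w P Q" "e' \<in> heavy_cells w P Q"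
      "snd e \<inter> P = snd e' \<inter> P" "e \<noteq> e'"
    have "card (snd e \<inter> P) \<le> 1"
      by (rule card_le_1I) (use e heavy_cells_meet[OF e(1,2,4)] in blast)
    moreover have "w \<le> real (card (snd e \<inter> P))" by (rule heavy_cellsD(4)[OF e(1)])
    ultimately show False using assms(2) by linarith
  qed
qed (use assms in auto)

section \<open>Families of sets that pairwise share at most one point\<close>

text \<open>The sets are added one at a time. Each new set loses at most one point to every earlier
  one, and these losses add up to at most half the square of the number of sets.\<close>

lemma card_Union_almost_disjoint:
  fixes A :: "'i \<Rightarrow> 'a set"
  assumes "finite I" "\<And>i. i \<in> I \<Longrightarrow> finite (A i)" "\<And>i. i \<in> I \<Longrightarrow> k \<le> real (card (A i))"
    and "\<And>i j. i \<in> I \<Longrightarrow> j \<in> I \<Longrightarrow> i \<noteq> j \<Longrightarrow> card (A i \<inter> A j) \<le> 1"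
  shows "real (card I) * k - (real (card I))\<^sup>2 / 2 \<le> real (card (\<Union>i\<in>I. A i))"
  using assms
proof (induction I rule: finite_induct)
  case empty
  then show ?case by simp
next
  case (insert i I)
  let ?U = "\<Union>i\<in>I. A i"
  have fin: "finite ?U" "finite (A i)" using insert by auto
  have "A i \<inter> ?U = (\<Union>j\<in>I. A i \<inter> A j)" by blast
  then have "card (A i \<inter> ?U) \<le> (\<Sum>j\<in>I. card (A i \<inter> A j))"
    using card_UN_le[OF insert.hyps(1)] by metis
  also have "\<dots> \<le> (\<Sum>j\<in>I. 1)"
    using insert by (intro sum_mono insert.prems(3)) auto
  finally have "real (card (A i \<inter> ?U)) \<le> real (card I)" by simp
  moreover have "card (A i) + card ?U = card (A i \<union> ?U) + card (A i \<inter> ?U)"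
    by (rule card_Un_Int[OF fin(2) fin(1)])
  then have "real (card (A i)) + real (card ?U) = real (card (A i \<union> ?U)) + real (card (A i \<inter> ?U))"
    by (metis of_nat_add)
  moreover have "real (card I) * k - (real (card I))\<^sup>2 / 2 \<le> real (card ?U)"
    using insert by simp
  moreover have "k \<le> real (card (A i))" using insert by simp
  ultimately have "real (card I) * k - (real (card I))\<^sup>2 / 2 + k - real (card I) \<le> real (card (A i \<union> ?U))"
    by linarith
  moreover have "real (card (insert i I)) * k - (real (card (insert i I)))\<^sup>2 / 2 =
      real (card I) * k - (real (card I))\<^sup>2 / 2 + k - real (card I) - 1 / 2"
    using insert.hyps by (simp add: power2_eq_square algebra_simps add_divide_distrib)
  ultimately show ?case by simp
qed

text \<open>The quadratic loss is harmless only for at most \<open>k\<close> sets. Hence a subfamily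
  of \<open>m\<close> sets is taken with \<open>m\<close> barely above \<open>2 * N / k\<close>; it
  would cover at least \<open>m * k / 2 > N\<close> points.\<close>

lemma few_almost_disjoint_sets:
  fixes A :: "'i \<Rightarrow> 'a set" and k :: real
  assumes "finite X" "\<And>i. i \<in> I \<Longrightarrow> A i \<subseteq> X" "\<And>i. i \<in> I \<Longrightarrow> k \<le> real (card (A i))"
    and meet: "\<And>i j. i \<in> I \<Longrightarrow> j \<in> I \<Longrightarrow> i \<noteq> j \<Longrightarrow> card (A i \<inter> A j) \<le> 1"
    and N: "real (card X) \<le> N" "k > 0" "2 * N / k + 1 \<le> k"
  shows "real (card I) \<le> 2 * N / k"
proof (rule ccontr)
  assume "\<not> ?thesis"
  then have less: "2 * N / k < real (card I)" by simp
  define m where "m = nat \<lfloor>2 * N / k\<rfloor> + 1"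
  have "0 \<le> 2 * N / k" using N(1,2) by (auto intro!: divide_nonneg_nonneg order_trans[OF _ N(1)])
  then have m: "2 * N / k < real m" "real m \<le> 2 * N / k + 1"
    unfolding m_def by linarith+
  have "\<lfloor>2 * N / k\<rfloor> < int (card I)" using less by linarith
  then have "m \<le> card I" using \<open>0 \<le> 2 * N / k\<close> unfolding m_def by (simp add: nat_less_iff Suc_le_eq)
  then obtain I' where I': "I' \<subseteq> I" "card I' = m" "finite I'"
    using obtain_subset_with_card_n[of m I] by auto
  have "real m * k - (real m)\<^sup>2 / 2 \<le> real (card (\<Union>i\<in>I'. A i))"
    using card_Union_almost_disjoint[of I' A k] I' assms(1-3) meet
    by (metis (no_types, opaque_lifting) finite_subset subsetD)
  also have "\<dots> \<le> N"
  proof -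
    have "card (\<Union>i\<in>I'. A i) \<le> card X"
      using I' assms(1,2) by (intro card_mono) blast+
    then show ?thesis using N(1) by linarith
  qed
  finally have 1: "real m * k - (real m)\<^sup>2 / 2 \<le> N" .
  have "(real m)\<^sup>2 \<le> real m * k"
    unfolding power2_eq_square using m N(3) by (intro mult_left_mono) auto
  with 1 have "real m * k \<le> 2 * N" by linarith
  with m(1) N(2) show False by (simp add: field_simps)
qed

section \<open>Confining a cell\<close>

lemma int_least_above:
  fixes S :: "int set"
  assumes "x \<in> S" "\<And>y. y \<in> S \<Longrightarrow> b \<le> y"
  obtains m where "m \<in> S" "\<And>y. y \<in> S \<Longrightarrow> m \<le> y"
proof -
  obtain m where "m \<in> S" "\<And>y. y \<in> S \<Longrightarrow> nat (m - b) \<le> nat (y - b)"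
    using ex_has_least_nat[of "\<lambda>y. y \<in> S" x "\<lambda>y. nat (y - b)"] assms(1) by blast
  then show ?thesis using assms(2) by (intro that[of m]) (auto simp: nat_le_eq_zle)
qed

text \<open>The set \<open>R\<close> consists, for each positive multiple \<open>j h\<close>, of the least element of \<open>U\<close> that has
  at least \<open>j h\<close> elements of \<open>A\<close> to its left.\<close>

lemma one_sided_blocking_set:
  fixes A U :: "int set"
  assumes A: "finite A" and h: "h > 0"
  shows "\<exists>R\<subseteq>U. finite R \<and> card R \<le> card A div h \<and>
    (\<forall>f\<in>U. card {a \<in> A. a < f \<and> (\<forall>r\<in>R. \<not> (a \<le> r \<and> r \<le> f))} \<le> h)"
proof -
  define F where "F u = card {a \<in> A. a < u}" for u
  define G where "G j m \<longleftrightarrow> m \<in> U \<and> j * h \<le> F m \<and> (\<forall>u\<in>U. j * h \<le> F u \<longrightarrow> m \<le> u)" for j m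
  have ex: "\<exists>m. G j m" if u: "u \<in> U" "j * h \<le> F u" and j: "j > 0" for u j
  proof -
    \<comment> \<open>An element with \<open>j * h > 0\<close> elements of \<open>A\<close> to its
      left exceeds \<open>Min A\<close>. This lower bound makes a least such element exist.\<close>
    have "Min A \<le> y" if "y \<in> {y \<in> U. j * h \<le> F y}" for y
    proof -
      have "0 < F y" using that h j by (metis (no_types, lifting) gr_zeroI leD mem_Collect_eq mult_pos_pos)
      then obtain a where "a \<in> A" "a < y" unfolding F_def by (auto simp: card_gt_0_iff)
      then show ?thesis using A Min_le[of A a] by linarith
    qed
    then obtain m where "m \<in> {y \<in> U. j * h \<le> F y}" "\<And>y. y \<in> {y \<in> U. j * h \<le> F y} \<Longrightarrow> m \<le> y"
      using int_least_above[of u "{y \<in> U. j * h \<le> F y}" "Min A"] u by auto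
    then show ?thesis unfolding G_def by blast
  qed
  define g where "g j = (SOME m. G j m)" for j
  define R where "R = g ` {j \<in> {1..card A div h}. \<exists>m. G j m}"
  have gG: "G j (g j)" if "\<exists>m. G j m" for j using someI_ex[OF that] by (simp add: g_def)
  show ?thesis
  proof (intro exI[of _ R] conjI ballI)
    show "R \<subseteq> U" unfolding R_def using gG by (force simp: G_def[of _ "g _"])
    show "finite R" unfolding R_def by simp
    have "card R \<le> card {j \<in> {1..card A div h}. \<exists>m. G j m}"
      unfolding R_def by (rule card_image_le) simp
    also have "\<dots> \<le> card {1..card A div h}" by (rule card_mono) auto
    finally show "card R \<le> card A div h" by simp
  next
    fix f assume f: "f \<in> U"
    let ?C = "{a \<in> A. a < f \<and> (\<forall>r\<in>R. \<not> (a \<le> r \<and> r \<le> f))}"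
    define j where "j = F f div h"
    have Fj: "F f < j * h + h" "j * h \<le> F f"
      unfolding j_def using div_mult_mod_eq[of "F f" h] mod_less_divisor[OF h, of "F f"] by linarith+
    show "card ?C \<le> h"
    proof (cases "j = 0")
      case True
      have "card ?C \<le> F f" unfolding F_def using A by (intro card_mono) auto
      then show ?thesis using Fj True by simp
    next
      case False
      have Gj: "G j (g j)" using ex[OF f Fj(2)] False gG by blast
      have "F f \<le> card A" unfolding F_def using A by (intro card_mono) auto
      then have "j \<le> card A div h" unfolding j_def by (rule div_le_mono)
      then have "g j \<in> R" unfolding R_def using False Gj by auto
      moreover have gf: "g j \<le> f" using Gj f Fj(2) by (simp add: G_def)
      ultimately have "?C \<subseteq> {a \<in> A. a < f} - {a \<in> A. a < g j}" by auto
      then have "card ?C \<le> card ({a \<in> A. a < f} - {a \<in> A. a < g j})"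
        using A by (intro card_mono) auto
      also have "\<dots> = F f - F (g j)"
        unfolding F_def using A gf by (intro card_Diff_subset) auto
      also have "\<dots> \<le> h" using Gj Fj unfolding G_def by linarith
      finally show ?thesis .
    qed
  qed
qed

text \<open>The one-sided lemma is applied to the sets and to their mirror images. Excluding
  \<open>f \<in> A\<close> puts every element of \<open>A\<close> strictly on one side of
  \<open>f\<close>.\<close>

lemma blocking_set:
  fixes A U :: "int set"
  assumes A: "finite A" and h: "h > 0"
  shows "\<exists>R\<subseteq>U. finite R \<and> card R \<le> 2 * (card A div h) \<and>
    (\<forall>f\<in>U - A. card {a \<in> A. \<forall>r\<in>R. \<not> (min a f \<le> r \<and> r \<le> max a f)} \<le> 2 * h)"
proof -
  obtain R1 where R1: "R1 \<subseteq> U" "finite R1" "card R1 \<le> card A div h"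
    "\<forall>f\<in>U. card {a \<in> A. a < f \<and> (\<forall>r\<in>R1. \<not> (a \<le> r \<and> r \<le> f))} \<le> h"
    using one_sided_blocking_set[OF A h, of U] by blast
  obtain R2 where R2: "R2 \<subseteq> uminus ` U" "finite R2" "card R2 \<le> card (uminus ` A) div h"
    "\<forall>f\<in>uminus ` U. card {a \<in> uminus ` A. a < f \<and> (\<forall>r\<in>R2. \<not> (a \<le> r \<and> r \<le> f))} \<le> h"
    using one_sided_blocking_set[OF finite_imageI[OF A] h, of "uminus ` U" uminus] by blast
  have cA: "card (uminus ` A) = card A" by (rule card_image) auto
  show ?thesis
  proof (intro exI[of _ "R1 \<union> uminus ` R2"] conjI ballI)
    show "R1 \<union> uminus ` R2 \<subseteq> U" using R1 R2 by auto
    show "finite (R1 \<union> uminus ` R2)" using R1 R2 by auto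
    have "card (R1 \<union> uminus ` R2) \<le> card R1 + card (uminus ` R2)" by (rule card_Un_le)
    also have "card (uminus ` R2) = card R2" by (rule card_image) auto
    finally show "card (R1 \<union> uminus ` R2) \<le> 2 * (card A div h)" using R1(3) R2(3) cA by simp
  next
    fix f assume "f \<in> U - A"
    then have f: "f \<in> U" "f \<notin> A" by auto
    let ?C = "{a \<in> A. \<forall>r\<in>R1 \<union> uminus ` R2. \<not> (min a f \<le> r \<and> r \<le> max a f)}"
    let ?C1 = "{a \<in> A. a < f \<and> (\<forall>r\<in>R1. \<not> (a \<le> r \<and> r \<le> f))}"
    let ?C2 = "{a \<in> uminus ` A. a < - f \<and> (\<forall>r\<in>R2. \<not> (a \<le> r \<and> r \<le> - f))}"
    have "?C \<subseteq> ?C1 \<union> uminus ` ?C2"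
    proof
      fix a assume a: "a \<in> ?C"
      have "a \<noteq> f" using a f by blast
      then consider "a < f" | "a > f" by linarith
      then show "a \<in> ?C1 \<union> uminus ` ?C2"
      proof cases
        case 1
        then show ?thesis using a by (auto simp: min_def max_def)
      next
        case 2
        have "- a \<in> ?C2"
        proof (intro CollectI conjI ballI notI)
          fix r assume r: "r \<in> R2" "- a \<le> r \<and> r \<le> - f"
          then have "min a f \<le> - r \<and> - r \<le> max a f" using 2 by linarith
          with a r(1) show False by blast
        qed (use a 2 in auto)
        then have "- (- a) \<in> uminus ` ?C2" by (rule imageI)
        then show ?thesis by simp
      qed
    qed
    then have "card ?C \<le> card (?C1 \<union> uminus ` ?C2)" using A by (intro card_mono) auto
    also have "\<dots> \<le> card ?C1 + card (uminus ` ?C2)" by (rule card_Un_le)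
    also have "card (uminus ` ?C2) \<le> card ?C2" by (rule card_image_le) (use A in auto)
    finally show "card ?C \<le> 2 * h" using bspec[OF R1(4) f(1)] bspec[OF R2(4) imageI[OF f(1)]] by linarith
  qed
qed

text \<open>Quantifying over all \<open>Q\<close> that contain \<open>X\<close> makes confinement
  survive Breaker's later moves. Only the Maker points \<open>P\<close> present at the time are
  counted, and full pieces are exempt.\<close>

definition confines :: "nat \<Rightarrow> point set \<Rightarrow> point set \<Rightarrow> point set \<Rightarrow> point set \<Rightarrow> bool" where
  "confines h P l J X \<longleftrightarrow>
     (\<forall>Q f. X \<subseteq> Q \<longrightarrow> f \<in> J - (P \<union> Q) \<longrightarrow> card (line_cell Q l f \<inter> J \<inter> P) \<le> 2 * h)"

lemma confinesD:
  "confines h P l J X \<Longrightarrow> X \<subseteq> Q \<Longrightarrow> f \<in> J - (P \<union> Q) \<Longrightarrow> card (line_cell Q l f \<inter> J \<inter> P) \<le> 2 * h"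
  unfolding confines_def by blast

lemma confines_mono: "confines h P l J X \<Longrightarrow> X \<subseteq> Y \<Longrightarrow> confines h P l J Y"
  by (auto simp: confines_def)

text \<open>\<open>blocking_set\<close> is applied to the coordinates of Maker's points, with the
  other points of the cell as admissible marks.\<close>

lemma confining_set:
  assumes l: "l \<in> lattice_lines" and J: "J \<subseteq> l" and P: "finite P" and h: "h > 0"
  obtains R where "R \<subseteq> J - P" "finite R" "card R \<le> 2 * (card (J \<inter> P) div h)" "confines h P l J R"
proof -
  let ?\<tau> = "line_coord l"
  have inj: "inj_on ?\<tau> J" using inj_on_line_coord[OF l] J by (rule inj_on_subset)
  obtain R where R: "R \<subseteq> ?\<tau> ` (J - P)" "finite R" "card R \<le> 2 * (card (?\<tau> ` (J \<inter> P)) div h)"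
    "\<forall>f\<in>?\<tau> ` (J - P) - ?\<tau> ` (J \<inter> P).
       card {a \<in> ?\<tau> ` (J \<inter> P). \<forall>r\<in>R. \<not> (min a f \<le> r \<and> r \<le> max a f)} \<le> 2 * h"
    using blocking_set[of "?\<tau> ` (J \<inter> P)" h "?\<tau> ` (J - P)"] P h by blast
  obtain R' where R': "R' \<subseteq> J - P" "R = ?\<tau> ` R'" using R(1) by (meson subset_image_iff)
  have injR: "inj_on ?\<tau> R'" using inj R'(1) by (meson Diff_subset inj_on_subset order_trans)
  show ?thesis
  proof (rule that[of R'])
    show "R' \<subseteq> J - P" by fact
    show "finite R'" using R(2) R'(2) injR finite_image_iff by blast
    have "card (?\<tau> ` (J \<inter> P)) = card (J \<inter> P)"
      by (rule card_image) (use inj in \<open>auto intro: inj_on_subset\<close>)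
    then show "card R' \<le> 2 * (card (J \<inter> P) div h)"
      using R(3) R'(2) card_image[OF injR] by simp
    show "confines h P l J R'"
      unfolding confines_def
    proof (intro allI impI)
      fix Q f assume Q: "R' \<subseteq> Q" and f: "f \<in> J - (P \<union> Q)"
      let ?C = "line_cell Q l f \<inter> J \<inter> P"
      let ?D = "{a \<in> ?\<tau> ` (J \<inter> P). \<forall>r\<in>R. \<not> (min a (?\<tau> f) \<le> r \<and> r \<le> max a (?\<tau> f))}"
      have "?\<tau> ` ?C \<subseteq> ?D"
        using Q J R'(1) unfolding R'(2) line_cell_def by auto
      then have "card (?\<tau> ` ?C) \<le> card ?D" using P by (intro card_mono) auto
      moreover have "card (?\<tau> ` ?C) = card ?C"
        by (rule card_image) (use inj in \<open>auto intro: inj_on_subset\<close>)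
      moreover have "?\<tau> f \<notin> ?\<tau> ` (J \<inter> P)"
        using f inj by (auto dest: inj_onD)
      ultimately show "card ?C \<le> 2 * h" using bspec[OF R(4), of "?\<tau> f"] f by auto
    qed
  qed
qed

section \<open>Breaker's replies\<close>

text \<open>Breaker can afford to confine \<open>k\<close> cells. He spends this budget on cells of weight \<open>w\<close>, and
  cells of the larger weight \<open>w'\<close> have priority.\<close>

definition good_reply ::
  "nat \<Rightarrow> real \<Rightarrow> real \<Rightarrow> nat \<Rightarrow> point set \<Rightarrow> point set \<Rightarrow> turn \<Rightarrow> (point set \<times> point set) set \<Rightarrow> bool" where
  "good_reply h w w' k P Q X S \<longleftrightarrow>
     S \<subseteq> heavy_cells w P Q \<and> (\<forall>(l, J)\<in>S. confines h P l J X) \<and>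
     (card (heavy_cells w' P Q) \<le> k \<longrightarrow> heavy_cells w' P Q \<subseteq> S) \<and>
     (S = heavy_cells w P Q \<or> card S = k)"

text \<open>Breaker has to claim exactly \<open>t\<close> points. Surplus moves are harmless, as
  confinement is monotone.\<close>

lemma exists_legal_extension:
  assumes "finite C" "finite X" "X \<inter> C = {}" "card X \<le> t"
  obtains Y where "X \<subseteq> Y" "legal_turn t C Y"
proof -
  have "infinite (UNIV :: point set)" by (simp add: finite_prod)
  then have "infinite (UNIV - (C \<union> X))" using assms by (intro Diff_infinite_finite) auto
  then obtain Z where Z: "finite Z" "card Z = t - card X" "Z \<subseteq> UNIV - (C \<union> X)"
    using infinite_arbitrarily_large by blast
  have "card (X \<union> Z) = card X + card Z" using Z assms by (intro card_Un_disjoint) auto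
  then show ?thesis
    using Z assms by (intro that[of "X \<union> Z"]) (auto simp: legal_turn_def)
qed

text \<open>Confining a cell with at most \<open>n\<close> Maker points costs at most
  \<open>2 * (n div h)\<close> points, so \<open>t\<close> points pay for \<open>k\<close> cells.
  The rest of the turn is filled up arbitrarily.\<close>

lemma exists_good_reply:
  assumes P: "finite P" and Q: "finite Q" and h: "h > 0" and w: "1 < w" "w \<le> w'"
    and small: "\<And>l J. (l, J) \<in> heavy_cells w P Q \<Longrightarrow> card (J \<inter> P) \<le> n"
    and k: "k * (2 * (n div h)) \<le> t"
  shows "\<exists>X S. legal_turn t (P \<union> Q) X \<and> good_reply h w w' k P Q X S"
proof -
  let ?H = "heavy_cells w P Q" and ?H' = "heavy_cells w' P Q"
  have fin: "finite ?H" using P w by (intro finite_heavy_cells) auto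
  have sub: "?H' \<subseteq> ?H" using w by (intro heavy_cells_antimono)
  have "\<exists>S\<subseteq>?H. card S \<le> k \<and> (card ?H' \<le> k \<longrightarrow> ?H' \<subseteq> S) \<and> (S = ?H \<or> card S = k)"
  proof (cases "card ?H \<le> k")
    case True
    then show ?thesis using sub by blast
  next
    case False
    show ?thesis
    proof (cases "card ?H' \<le> k")
      case True
      then obtain S where "?H' \<subseteq> S" "S \<subseteq> ?H" "card S = k"
        using exists_subset_between[of ?H' k ?H] False sub fin by auto
      then show ?thesis by blast
    next
      case 2: False
      obtain S where "S \<subseteq> ?H" "card S = k"
        using obtain_subset_with_card_n[of k ?H] False by (metis nat_le_linear)
      then show ?thesis using 2 by blast
    qed
  qed
  then obtain S where S: "S \<subseteq> ?H" "card S \<le> k" "card ?H' \<le> k \<longrightarrow> ?H' \<subseteq> S" "S = ?H \<or> card S = k"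
    by blast
  have "\<exists>R. R \<subseteq> snd e - P \<and> finite R \<and> card R \<le> 2 * (n div h) \<and> confines h P (fst e) (snd e) R"
    if "e \<in> S" for e
  proof -
    have "e \<in> ?H" using that S(1) by blast
    then have e: "fst e \<in> lattice_lines" "snd e \<subseteq> fst e" "card (snd e \<inter> P) \<le> n"
      using heavy_cellsD(1,2) small[of "fst e" "snd e"] by auto
    obtain R where R: "R \<subseteq> snd e - P" "finite R" "card R \<le> 2 * (card (snd e \<inter> P) div h)"
      "confines h P (fst e) (snd e) R"
      using confining_set[OF e(1,2) P h] .
    moreover have "card (snd e \<inter> P) div h \<le> n div h" using e(3) by (rule div_le_mono)
    ultimately show ?thesis by (meson mult_le_mono2 order_trans)
  qed
  then obtain R where R: "\<And>e. e \<in> S \<Longrightarrow> R e \<subseteq> snd e - P \<and> finite (R e) \<and>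
      card (R e) \<le> 2 * (n div h) \<and> confines h P (fst e) (snd e) (R e)"
    by metis
  let ?X = "\<Union>e\<in>S. R e"
  have finS: "finite S" using S(1) fin by (rule finite_subset)
  have "card ?X \<le> (\<Sum>e\<in>S. card (R e))" by (rule card_UN_le[OF finS])
  also have "\<dots> \<le> (\<Sum>e\<in>S. 2 * (n div h))" using R by (intro sum_mono) auto
  also have "\<dots> \<le> k * (2 * (n div h))" using S(2) by simp
  also have "\<dots> \<le> t" by (rule k)
  finally have "card ?X \<le> t" .
  moreover have "?X \<inter> (P \<union> Q) = {}"
  proof -
    have "snd e \<inter> Q = {}" if "e \<in> S" for e
      using that S(1) by (intro heavy_cellsD(3)) blast
    then show ?thesis using R by blast
  qed
  moreover have "finite ?X" using R finS by auto
  ultimately obtain Y where Y: "?X \<subseteq> Y" "legal_turn t (P \<union> Q) Y"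
    using exists_legal_extension[of "P \<union> Q" ?X t] P Q by auto
  have "confines h P (fst e) (snd e) Y" if "e \<in> S" for e
    using R[OF that] Y(1) that by (meson UN_upper confines_mono order_trans)
  then have "good_reply h w w' k P Q Y S"
    unfolding good_reply_def using S by (simp add: case_prod_beta)
  then show ?thesis using Y(2) by blast
qed

text \<open>Such a cell would lie inside a cell that had weight \<open>w'\<close> before the reply.
  The budget covered that cell, so it was confined, and its pieces with an unclaimed point have at
  most \<open>2 * h\<close> Maker points.\<close>

lemma no_heavy_cells_after_reply:
  assumes good: "good_reply h w w' k P Q X S" and k: "card (heavy_cells w' P Q) \<le> k"
    and h: "2 * real h < w'" and Q': "Q \<union> X \<subseteq> Q'" and P: "finite P"
  shows "heavy_cells w' P Q' = {}"
proof (rule equals0I)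
  fix e assume "e \<in> heavy_cells w' P Q'"
  then obtain l f where l: "l \<in> lattice_lines" "f \<in> l - (P \<union> Q')" "w' \<le> real (card (line_cell Q' l f \<inter> P))"
    unfolding heavy_cells_def by blast
  let ?J = "line_cell Q l f"
  have f: "f \<in> line_cell Q' l f" "f \<in> ?J" using l Q' by (auto intro!: in_line_cell_self)
  have sub: "line_cell Q' l f \<subseteq> ?J" using line_cell_mono[of Q Q' f l f f] Q' f by blast
  have "card (line_cell Q' l f \<inter> P) \<le> card (?J \<inter> P)" using P sub by (intro card_mono) auto
  then have "(l, ?J) \<in> heavy_cells w' P Q" using l Q' unfolding heavy_cells_def by auto
  then have "confines h P l ?J X" using good k unfolding good_reply_def by blast
  then have "card (line_cell Q' l f \<inter> ?J \<inter> P) \<le> 2 * h"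
    by (rule confinesD) (use Q' l f in auto)
  moreover have "line_cell Q' l f \<inter> ?J = line_cell Q' l f" using sub by blast
  ultimately show False using l(3) h by simp
qed

section \<open>Winning segments in line coordinates\<close>

text \<open>Coordinates replace segments in the plane. Considering all pairs from \<open>S\<close>
  spares naming its two ends and covers both orientations of the coordinate.\<close>

definition line_win :: "nat \<Rightarrow> point set \<Rightarrow> point set \<Rightarrow> bool" where
  "line_win n P Q \<longleftrightarrow> (\<exists>l\<in>lattice_lines. \<exists>S\<subseteq>P \<inter> l. finite S \<and> card S = n \<and>
     (\<forall>a\<in>S. \<forall>b\<in>S. \<forall>q\<in>Q \<inter> l. \<not> (line_coord l a \<le> line_coord l q \<and> line_coord l q \<le> line_coord l b)))"

lemma line_winI:
  assumes "l \<in> lattice_lines" "S \<subseteq> P" "S \<subseteq> l" "finite S" "card S = n"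
    "\<And>a b q. a \<in> S \<Longrightarrow> b \<in> S \<Longrightarrow> q \<in> Q \<inter> l \<Longrightarrow>
       \<not> (line_coord l a \<le> line_coord l q \<and> line_coord l q \<le> line_coord l b)"
  shows "line_win n P Q"
  unfolding line_win_def
  by (rule bexI[OF _ assms(1)], rule exI[of _ S]) (use assms(2-) in simp)

lemma line_winE:
  assumes "line_win n P Q"
  obtains l S where "l \<in> lattice_lines" "S \<subseteq> P" "S \<subseteq> l" "finite S" "card S = n"
    "\<And>a b q. a \<in> S \<Longrightarrow> b \<in> S \<Longrightarrow> q \<in> Q \<inter> l \<Longrightarrow>
       \<not> (line_coord l a \<le> line_coord l q \<and> line_coord l q \<le> line_coord l b)"
proof -
  from assms obtain l where l: "l \<in> lattice_lines" and *: "\<exists>S\<subseteq>P \<inter> l. finite S \<and> card S = n \<and>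
     (\<forall>a\<in>S. \<forall>b\<in>S. \<forall>q\<in>Q \<inter> l. \<not> (line_coord l a \<le> line_coord l q \<and> line_coord l q \<le> line_coord l b))"
    unfolding line_win_def by (rule bexE)
  from * obtain S where "S \<subseteq> P \<inter> l" "finite S" "card S = n"
    "\<forall>a\<in>S. \<forall>b\<in>S. \<forall>q\<in>Q \<inter> l. \<not> (line_coord l a \<le> line_coord l q \<and> line_coord l q \<le> line_coord l b)"
    by (elim exE conjE)
  then show ?thesis by (intro that[OF l, of S]) auto
qed

lemma inj_real_point: "inj real_point"
  by (auto simp: inj_def real_point_def prod_eq_iff)

lemma line_through_lattice_line:
  assumes "a \<noteq> b"
  shows "{r. (fst r - fst a) * (snd b - snd a) = (snd r - snd a) * (fst b - fst a)} \<in> lattice_lines"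
proof -
  have "{r. (fst r - fst a) * (snd b - snd a) = (snd r - snd a) * (fst b - fst a)} =
      {r. (snd b - snd a) * fst r + (fst a - fst b) * snd r = (snd b - snd a) * fst a + (fst a - fst b) * snd a}"
    by (auto simp: algebra_simps)
  moreover have "(snd b - snd a, fst a - fst b) \<noteq> (0, 0)" using assms by (auto simp: prod_eq_iff)
  ultimately show ?thesis unfolding lattice_lines_def by blast
qed

lemma line_coord_affine:
  assumes l: "l \<in> lattice_lines"
    and r: "real_point r = (1 - u) *\<^sub>R real_point a + u *\<^sub>R real_point b"
  shows "real_of_int (line_coord l r) = (1 - u) * real_of_int (line_coord l a) + u * real_of_int (line_coord l b)"
proof -
  obtain x y c where xy: "line_coord l = (\<lambda>p. x * snd p - y * fst p)"
    using line_coordE[OF l] by metis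
  have "real_of_int (fst r) = (1 - u) * real_of_int (fst a) + u * real_of_int (fst b)"
    "real_of_int (snd r) = (1 - u) * real_of_int (snd a) + u * real_of_int (snd b)"
    using r by (auto simp: real_point_def)
  then show ?thesis by (simp add: xy) (simp add: algebra_simps)
qed

lemma in_closed_segment_if_between:
  assumes l: "l \<in> lattice_lines" and mem: "a \<in> l" "b \<in> l" "q \<in> l"
    and le: "line_coord l a \<le> line_coord l q" "line_coord l q \<le> line_coord l b"
  shows "real_point q \<in> closed_segment (real_point a) (real_point b)"
proof (cases "line_coord l a = line_coord l b")
  case True
  then have "q = a" using le inj_onD[OF inj_on_line_coord[OF l], of q a] mem by simp
  then show ?thesis by simp
next
  case False
  obtain \<xi> \<eta> :: real where \<xi>\<eta>: "\<forall>p\<in>l. \<forall>q\<in>l.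
     real_of_int (fst p) - real_of_int (fst q) = \<xi> * (real_of_int (line_coord l p) - real_of_int (line_coord l q)) \<and>
     real_of_int (snd p) - real_of_int (snd q) = \<eta> * (real_of_int (line_coord l p) - real_of_int (line_coord l q))"
    using line_coord_param[OF l] by blast
  define D where "D = real_of_int (line_coord l b) - real_of_int (line_coord l a)"
  define u where "u = (real_of_int (line_coord l q) - real_of_int (line_coord l a)) / D"
  have D: "D > 0" using False le unfolding D_def by linarith
  have u: "0 \<le> u" "u \<le> 1" using D le unfolding u_def D_def by (auto simp: divide_le_eq)
  have uD: "u * D = real_of_int (line_coord l q) - real_of_int (line_coord l a)" using D by (simp add: u_def)
  have b: "real_of_int (fst b) - real_of_int (fst a) = \<xi> * D" "real_of_int (snd b) - real_of_int (snd a) = \<eta> * D"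
    using bspec[OF bspec[OF \<xi>\<eta> mem(2)] mem(1)] by (auto simp: D_def)
  have q: "real_of_int (fst q) - real_of_int (fst a) = \<xi> * (u * D)" "real_of_int (snd q) - real_of_int (snd a) = \<eta> * (u * D)"
    using bspec[OF bspec[OF \<xi>\<eta> mem(3)] mem(1)] unfolding uD by auto
  have "real_of_int (fst q) = (1 - u) * real_of_int (fst a) + u * real_of_int (fst b)"
    "real_of_int (snd q) = (1 - u) * real_of_int (snd a) + u * real_of_int (snd b)"
    using b q by (auto simp: algebra_simps)
  then show ?thesis using u unfolding in_segment by (auto simp: real_point_def)
qed

text \<open>As \<open>n \<ge> 2\<close>, the ends \<open>a\<close> and \<open>b\<close> are distinct
  and span a lattice line, which contains \<open>S\<close>. A Breaker point between two points of
  \<open>S\<close> would lie on the segment from \<open>a\<close> to \<open>b\<close>.\<close>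

lemma line_win_if_winning_segment:
  assumes n: "n \<ge> 2" and win: "winning_segment n P Q"
  shows "line_win n P Q"
proof -
  obtain S a b where S: "S \<subseteq> P" "finite S" "card S = n" and ab: "a \<in> S" "b \<in> S"
    and seg: "real_point ` S \<subseteq> closed_segment (real_point a) (real_point b)"
    and free: "real_point ` Q \<inter> closed_segment (real_point a) (real_point b) = {}"
    using win unfolding winning_segment_def by blast
  have "a \<noteq> b"
  proof
    assume "a = b"
    then have "S \<subseteq> {a}" using seg inj_real_point by (auto dest: injD)
    then have "card S \<le> card {a}" by (intro card_mono) auto
    then show False using S(3) n by simp
  qed
  define l where "l = {r. (fst r - fst a) * (snd b - snd a) = (snd r - snd a) * (fst b - fst a)}"
  have l: "l \<in> lattice_lines" unfolding l_def by (rule line_through_lattice_line[OF \<open>a \<noteq> b\<close>])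
  have abl: "a \<in> l" "b \<in> l" by (auto simp: l_def)
  have Sl: "r \<in> l \<and> min (line_coord l a) (line_coord l b) \<le> line_coord l r \<and>
      line_coord l r \<le> max (line_coord l a) (line_coord l b)" if "r \<in> S" for r
  proof -
    have "real_point r \<in> closed_segment (real_point a) (real_point b)" using seg that by blast
    then obtain u where u: "0 \<le> u" "u \<le> 1" and r: "real_point r = (1 - u) *\<^sub>R real_point a + u *\<^sub>R real_point b"
      unfolding in_segment by metis
    have "real_of_int (fst r) = (1 - u) * real_of_int (fst a) + u * real_of_int (fst b)"
      "real_of_int (snd r) = (1 - u) * real_of_int (snd a) + u * real_of_int (snd b)"
      using r by (auto simp: real_point_def)
    then have "real_of_int (fst r - fst a) * real_of_int (snd b - snd a) =
        real_of_int (snd r - snd a) * real_of_int (fst b - fst a)"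
      by simp (simp add: algebra_simps)
    then have "r \<in> l"
      unfolding l_def of_int_mult[symmetric] of_int_eq_iff by blast
    moreover have eq: "real_of_int (line_coord l r) = (1 - u) * real_of_int (line_coord l a) + u * real_of_int (line_coord l b)"
      by (rule line_coord_affine[OF l r])
    have "real_of_int (line_coord l r) \<in> closed_segment (real_of_int (line_coord l a)) (real_of_int (line_coord l b))"
      unfolding in_segment using u eq by auto
    then have "min (line_coord l a) (line_coord l b) \<le> line_coord l r \<and>
      line_coord l r \<le> max (line_coord l a) (line_coord l b)"
      by (auto simp: closed_segment_eq_real_ivl split: if_splits)
    ultimately show ?thesis by blast
  qed
  have hull: "False" if "a' \<in> S" "b' \<in> S" "q \<in> Q \<inter> l" "line_coord l a' \<le> line_coord l q" "line_coord l q \<le> line_coord l b'"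
    for a' b' q
  proof -
    have "min (line_coord l a) (line_coord l b) \<le> line_coord l q \<and> line_coord l q \<le> max (line_coord l a) (line_coord l b)"
      using Sl[OF that(1)] Sl[OF that(2)] that(4,5) by linarith
    then have "(line_coord l a \<le> line_coord l q \<and> line_coord l q \<le> line_coord l b) \<or>
        (line_coord l b \<le> line_coord l q \<and> line_coord l q \<le> line_coord l a)"
      by linarith
    then have "real_point q \<in> closed_segment (real_point a) (real_point b)"
      using in_closed_segment_if_between[OF l abl, of q] in_closed_segment_if_between[OF l abl(2,1), of q] that(3)
        closed_segment_commute by blast
    then show False using free that(3) by blast
  qed
  show ?thesis
  proof (rule line_winI[OF l S(1) _ S(2,3)])
    show "S \<subseteq> l" using Sl by blast
    show "\<not> (line_coord l a' \<le> line_coord l q \<and> line_coord l q \<le> line_coord l b')"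
      if "a' \<in> S" "b' \<in> S" "q \<in> Q \<inter> l" for a' b' q
      using hull[OF that] by blast
  qed
qed

text \<open>Cells are convex and avoid \<open>Q\<close>, so any \<open>n\<close> Maker points in one
  of them win.\<close>

lemma card_cell_less_if_no_win:
  assumes "\<not> line_win n P Q" "l \<in> lattice_lines"
  shows "card (line_cell Q l f \<inter> P) < n"
proof (rule ccontr)
  assume "\<not> ?thesis"
  then obtain S where S: "S \<subseteq> line_cell Q l f \<inter> P" "card S = n" "finite S"
    using obtain_subset_with_card_n[of n "line_cell Q l f \<inter> P"] by auto
  have "\<not> (line_coord l a \<le> line_coord l q \<and> line_coord l q \<le> line_coord l b)"
    if "a \<in> S" "b \<in> S" "q \<in> Q \<inter> l" for a b q
    using line_cell_convex[of a Q l f b q] line_cell_disjoint[of Q l f] that S(1) by blast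
  then have "line_win n P Q"
    using S assms(2) line_cell_subset[of Q l f] by (intro line_winI[of l S]) auto
  with assms(1) show False by simp
qed

lemma line_win_antimono: "line_win n P Q \<Longrightarrow> Q' \<subseteq> Q \<Longrightarrow> line_win n P Q'"
  by (elim line_winE, rule line_winI) blast+

text \<open>A newly winning set contains a point \<open>f\<close> of the turn \<open>M\<close>. As
  \<open>f\<close> was unclaimed, the set lies in the cell of \<open>f\<close>, which had fewer than
  \<open>w\<close> Maker points; even all of \<open>M\<close> does not complete it.\<close>

lemma no_line_win_step:
  assumes heavy: "heavy_cells w P Q = {}" and old: "\<not> line_win n P Q"
    and M: "finite M" "M \<inter> (P \<union> Q) = {}" "w + real (card M) \<le> real n"
    and P: "finite P"
  shows "\<not> line_win n (P \<union> M) Q"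
proof
  assume "line_win n (P \<union> M) Q"
  then obtain l S where l: "l \<in> lattice_lines" and S: "S \<subseteq> P \<union> M" "finite S" "card S = n" "S \<subseteq> l"
    and free: "\<And>a b q. a \<in> S \<Longrightarrow> b \<in> S \<Longrightarrow> q \<in> Q \<inter> l \<Longrightarrow>
      \<not> (line_coord l a \<le> line_coord l q \<and> line_coord l q \<le> line_coord l b)"
    by (rule line_winE) blast
  have "\<not> S \<subseteq> P" using old line_winI[OF l _ S(4,2,3) free] by blast
  then obtain f where f: "f \<in> S" "f \<notin> P" "f \<in> M" using S by blast
  have "S \<subseteq> line_cell Q l f"
  proof
    fix r assume r: "r \<in> S"
    then have "\<not> (min (line_coord l r) (line_coord l f) \<le> line_coord l q \<and>
       line_coord l q \<le> max (line_coord l r) (line_coord l f))" if "q \<in> Q \<inter> l" for q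
      using free[OF r f(1) that] free[OF f(1) r that] by linarith
    then show "r \<in> line_cell Q l f" using r S unfolding line_cell_def by blast
  qed
  then have "card (S \<inter> P) \<le> card (line_cell Q l f \<inter> P)" using P by (intro card_mono) auto
  moreover have "real (card (line_cell Q l f \<inter> P)) < w"
  proof (rule ccontr)
    assume "\<not> ?thesis"
    then have "(l, line_cell Q l f) \<in> heavy_cells w P Q"
      using l f M(2) S(4) unfolding heavy_cells_def by auto
    with heavy show False by blast
  qed
  moreover have "card S \<le> card (S \<inter> P) + card M"
  proof -
    have "card S \<le> card ((S \<inter> P) \<union> M)" using S M(1) by (intro card_mono) auto
    also have "\<dots> \<le> card (S \<inter> P) + card M" by (rule card_Un_le)
    finally show ?thesis .
  qed
  ultimately show False using S(3) M(3) by linarith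
qed

section \<open>Plays against confining replies\<close>

text \<open>\<open>P t\<close> and \<open>Q t\<close> are the points claimed by Maker and Breaker up to timestep \<open>t\<close>; Maker has
  already made his turn in timestep \<open>T + 1\<close>.\<close>

locale confining_play =
  fixes P Q X :: "nat \<Rightarrow> point set" and S :: "nat \<Rightarrow> (point set \<times> point set) set"
    and h :: nat and w w' :: real and k :: "nat \<Rightarrow> nat" and T :: nat
  assumes P_mono: "s \<le> t \<Longrightarrow> P s \<subseteq> P t"
    and Q_mono: "s \<le> t \<Longrightarrow> Q s \<subseteq> Q t"
    and X_subset: "1 \<le> t \<Longrightarrow> X t \<subseteq> Q t"
    and finite_P: "t \<le> Suc T \<Longrightarrow> finite (P t)"
    and P_0: "P 0 = {}"
    and P_growth: "s \<le> t \<Longrightarrow> t \<le> Suc T \<Longrightarrow> card (P t - P s) \<le> (t - s) * t"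
    and h_w: "2 * real h < w" and w: "1 < w"
    and good: "1 \<le> t \<Longrightarrow> t \<le> T \<Longrightarrow> good_reply h w w' (k t) (P t) (Q (t - 1)) (X t) (S t)"
begin

lemma S_heavy: "e \<in> heavy_cells w (P t) (Q (t - 1))" if "1 \<le> t" "t \<le> T" "e \<in> S t"
  using good[OF that(1,2)] that(3) unfolding good_reply_def by blast

lemma S_confined: "confines h (P t) (fst e) (snd e) (X t)" if "1 \<le> t" "t \<le> T" "e \<in> S t"
  using good[OF that(1,2)] that(3) unfolding good_reply_def by (simp add: case_prod_beta)

lemma finite_S: "finite (S t)" if "1 \<le> t" "t \<le> T"
  using S_heavy[OF that] finite_heavy_cells[OF finite_P w, of t "Q (t - 1)"] that
  by (meson finite_subset le_SucI subsetI)

lemma card_P: "t \<le> Suc T \<Longrightarrow> card (P t) \<le> t * t"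
  using P_growth[of 0 t] P_0 by simp

text \<open>The points charged to the processing of \<open>e\<close> at timestep \<open>s\<close>.
  Points of earlier processed cells of the same line are left out, so that each incidence of a point
  with a line is charged only once.\<close>

definition fresh :: "nat \<Rightarrow> point set \<times> point set \<Rightarrow> point set" where
  "fresh s e = {p \<in> snd e \<inter> P s. \<forall>s'\<in>{1..<s}. \<forall>e'\<in>S s'. fst e' = fst e \<longrightarrow> p \<notin> snd e' \<inter> P s'}"

text \<open>A cell that is processed again lies inside a cell processed earlier, which at that time left
  at most \<open>2 h\<close> Maker points between Breaker's points.\<close>

lemma card_fresh:
  assumes s: "1 \<le> s" "s \<le> T" and e: "e \<in> S s"
  shows "w - 2 * real h \<le> real (card (fresh s e))"
proof -
  define J where "J = snd e"
  define St where "St = J \<inter> P s - fresh s e"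
  obtain f where f: "f \<in> fst e - (P s \<union> Q (s - 1))" and J: "J = line_cell (Q (s - 1)) (fst e) f"
    using heavy_cellsD(5)[OF S_heavy[OF s e]] unfolding J_def by blast
  have l: "fst e \<in> lattice_lines" by (rule heavy_cellsD(1)[OF S_heavy[OF s e]])
  have fJ: "f \<in> J" unfolding J using in_line_cell_self[OF l] f by blast
  have finPs: "finite (P s)" using s finite_P by simp
  have "card St \<le> 2 * h"
  proof (cases "St = {}")
    case True
    then show ?thesis by simp
  next
    case False
    \<comment> \<open>Earlier timesteps that can make points of \<open>J\<close> stale. Only the
      last one, \<open>m\<close>, is examined: all of \<open>St\<close> was claimed by then, and the
      cell processed at \<open>m\<close> contains \<open>J\<close>.\<close>
    define D where "D = {s' \<in> {1..<s}. \<exists>e'\<in>S s'. fst e' = fst e \<and> snd e' \<inter> J \<noteq> {}}"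
    have St: "\<exists>s'\<in>D. p \<in> P s'" if p: "p \<in> St" for p
    proof -
      obtain s' e' where *: "s' \<in> {1..<s}" "e' \<in> S s'" "fst e' = fst e" "p \<in> snd e' \<inter> P s'"
        using p unfolding St_def fresh_def J_def by blast
      then have "snd e' \<inter> J \<noteq> {}" using p unfolding St_def by blast
      then have "s' \<in> D" unfolding D_def using * by blast
      then show ?thesis using * by blast
    qed
    have D: "finite D" unfolding D_def by simp
    have "D \<noteq> {}" using St False by blast
    define m where "m = Max D"
    have "m \<in> D" unfolding m_def using D \<open>D \<noteq> {}\<close> by (rule Max_in)
    then obtain e' where m: "1 \<le> m" "m < s" and e': "e' \<in> S m" "fst e' = fst e" "snd e' \<inter> J \<noteq> {}"
      unfolding D_def by auto
    have mT: "m \<le> T" using m s by simp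
    obtain f' where J': "snd e' = line_cell (Q (m - 1)) (fst e) f'"
      using heavy_cellsD(5)[OF S_heavy[OF m(1) mT e'(1)]] unfolding e'(2) by blast
    have sub: "J \<subseteq> snd e'"
    proof -
      obtain x where "x \<in> line_cell (Q (s - 1)) (fst e) f" "x \<in> line_cell (Q (m - 1)) (fst e) f'"
        using e'(3) unfolding J J' by blast
      then show ?thesis unfolding J J' using Q_mono[of "m - 1" "s - 1"] m by (intro line_cell_mono) auto
    qed
    have "St \<subseteq> J \<inter> P m"
    proof
      fix p assume p: "p \<in> St"
      obtain s' where s': "s' \<in> D" "p \<in> P s'" using St[OF p] by blast
      have "s' \<le> m" unfolding m_def using D s'(1) by (rule Max_ge)
      then show "p \<in> J \<inter> P m" using s'(2) P_mono[of s' m] p unfolding St_def by blast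
    qed
    then have "card St \<le> card (J \<inter> snd e' \<inter> P m)"
      using sub finite_P[of m] mT by (intro card_mono) auto
    also have "\<dots> \<le> 2 * h"
      unfolding J
    proof (rule confinesD[of h "P m" "fst e" "snd e'" "X m"])
      show "confines h (P m) (fst e) (snd e') (X m)"
        using S_confined[OF m(1) mT e'(1)] e'(2) by simp
      have "m \<le> s - 1" using m by simp
      then show "X m \<subseteq> Q (s - 1)" using X_subset[OF m(1)] Q_mono by blast
      show "f \<in> snd e' - (P m \<union> Q (s - 1))"
        using fJ sub f P_mono[of m s] m by auto
    qed
    finally show ?thesis .
  qed
  moreover have "card (J \<inter> P s) \<le> card (fresh s e) + card St"
  proof -
    have "J \<inter> P s \<subseteq> fresh s e \<union> St" unfolding St_def by blast
    then have "card (J \<inter> P s) \<le> card (fresh s e \<union> St)"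
      using finPs by (intro card_mono) (auto simp: fresh_def St_def)
    also have "\<dots> \<le> card (fresh s e) + card St" by (rule card_Un_le)
    finally show ?thesis .
  qed
  moreover have "w \<le> real (card (J \<inter> P s))" unfolding J_def by (rule heavy_cellsD(4)[OF S_heavy[OF s e]])
  ultimately show ?thesis by linarith
qed

text \<open>If one timestep is earlier, its cell excludes the point from the later fresh set. Within
  a timestep, cells of a line with a common point are equal.\<close>

lemma fresh_disjoint:
  assumes "s \<in> {1..T}" "s' \<in> {1..T}" "e \<in> S s" "e' \<in> S s'" "fst e = fst e'"
    "p \<in> fresh s e" "p \<in> fresh s' e'"
  shows "s = s' \<and> e = e'"
proof -
  have "\<not> s < s'" "\<not> s' < s"
    using assms unfolding fresh_def by auto
  then have ss: "s = s'" by simp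
  have h: "e \<in> heavy_cells w (P s) (Q (s - 1))" "e' \<in> heavy_cells w (P s) (Q (s - 1))"
    using assms S_heavy[of s] ss by auto
  obtain f f' where J: "snd e = line_cell (Q (s - 1)) (fst e) f" "snd e' = line_cell (Q (s - 1)) (fst e) f'"
    using heavy_cellsD(5)[OF h(1)] heavy_cellsD(5)[OF h(2)] assms(5) by auto
  have p: "p \<in> snd e" "p \<in> snd e'" using assms(6,7) unfolding fresh_def by auto
  have "snd e = snd e'"
    unfolding J using p[unfolded J] line_cell_mono[OF order_refl] by (intro equalityI) blast+
  with ss assms(5) show ?thesis by (simp add: prod_eq_iff)
qed

text \<open>Double counting: every processed cell has at least \<open>w - 2 * h\<close> fresh
  points, and different processings yield different incidences with lines that are rich at time
  \<open>T\<close>.\<close>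

lemma processed_cells_bound:
  "real (\<Sum>s=1..T. card (S s)) * (w - 2 * real h) \<le>
     (\<Sum>l | l \<in> lattice_lines \<and> w \<le> real (card (l \<inter> P T)). real (card (l \<inter> P T)))"
proof -
  define L where "L = {l \<in> lattice_lines. w \<le> real (card (l \<inter> P T))}"
  have finL: "finite L" unfolding L_def using finite_rich_lines[OF finite_P[of T] w] by simp
  define Ev where "Ev = (SIGMA s:{1..T}. S s)"
  define A where "A = (SIGMA z:Ev. fresh (fst z) (snd z))"
  have finEv: "finite Ev" unfolding Ev_def using finite_S by auto
  have finF: "finite (fresh (fst z) (snd z))" if "z \<in> Ev" for z
    using that finite_P[of "fst z"] unfolding Ev_def fresh_def by auto
  define g where "g = (\<lambda>(z :: nat \<times> point set \<times> point set, p :: point). (fst (snd z), p))"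
  have "inj_on g A"
  proof (rule inj_onI)
    fix x y assume xy: "x \<in> A" "y \<in> A" "g x = g y"
    obtain s e p where x: "x = ((s, e), p)" by (metis surj_pair)
    obtain s' e' p' where y: "y = ((s', e'), p')" by (metis surj_pair)
    have "p = p'" "fst e = fst e'" using xy(3) unfolding x y g_def by auto
    moreover have "s \<in> {1..T}" "e \<in> S s" "p \<in> fresh s e" "s' \<in> {1..T}" "e' \<in> S s'" "p' \<in> fresh s' e'"
      using xy(1,2) unfolding x y A_def Ev_def by auto
    ultimately show "x = y" using fresh_disjoint[of s s' e e' p] unfolding x y by simp
  qed
  moreover have "g ` A \<subseteq> (SIGMA l:L. l \<inter> P T)"
  proof
    fix y assume "y \<in> g ` A"
    then obtain x where x: "x \<in> A" "y = g x" by blast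
    obtain s e p where xs: "x = ((s, e), p)" by (metis surj_pair)
    have s: "1 \<le> s" "s \<le> T" and e: "e \<in> S s" and p: "p \<in> fresh s e"
      using x(1) unfolding xs A_def Ev_def by auto
    note he = heavy_cellsD[OF S_heavy[OF s e]]
    have "card (snd e \<inter> P s) \<le> card (fst e \<inter> P T)"
      using he(2) P_mono[OF s(2)] finite_P[of T] by (intro card_mono) auto
    then have "fst e \<in> L" using he(1,4) unfolding L_def by auto
    moreover have "p \<in> fst e \<inter> P T" using p he(2) P_mono[OF s(2)] unfolding fresh_def by auto
    ultimately show "y \<in> (SIGMA l:L. l \<inter> P T)" unfolding x(2) xs g_def by simp
  qed
  moreover have "finite (SIGMA l:L. l \<inter> P T)" using finL finite_P[of T] by auto
  ultimately have "card A \<le> card (SIGMA l:L. l \<inter> P T)"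
    by (rule card_inj_on_le)
  moreover have "card (SIGMA l:L. l \<inter> P T) = (\<Sum>l\<in>L. card (l \<inter> P T))"
    using finL finite_P[of T] by (intro card_SigmaI) auto
  moreover have "card A = (\<Sum>z\<in>Ev. card (fresh (fst z) (snd z)))"
    unfolding A_def using finEv finF by (intro card_SigmaI) auto
  ultimately have "real (\<Sum>z\<in>Ev. card (fresh (fst z) (snd z))) \<le> real (\<Sum>l\<in>L. card (l \<inter> P T))"
    by (intro of_nat_mono) simp
  moreover have "real (card Ev) * (w - 2 * real h) \<le> (\<Sum>z\<in>Ev. real (card (fresh (fst z) (snd z))))"
    unfolding sum_constant[symmetric] by (rule sum_mono) (auto simp: Ev_def intro!: card_fresh)
  moreover have "card Ev = (\<Sum>s=1..T. card (S s))"
    unfolding Ev_def using finite_S by (intro card_SigmaI) auto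
  ultimately show ?thesis by (simp add: L_def)
qed

lemma saturated_if_cell_persists:
  assumes e: "e \<in> heavy_cells v (P (Suc T)) (Q T)" and a: "w \<le> real (card (snd e \<inter> P a))"
    and s: "a < s" "s \<le> T"
  shows "card (S s) = k s"
proof (rule ccontr)
  assume "card (S s) \<noteq> k s"
  have s1: "1 \<le> s" using s by simp
  then have S: "S s = heavy_cells w (P s) (Q (s - 1))"
    using good[OF s1 s(2)] \<open>card (S s) \<noteq> k s\<close> unfolding good_reply_def by blast
  obtain f where f: "f \<in> fst e - (P (Suc T) \<union> Q T)" and J: "snd e = line_cell (Q T) (fst e) f"
    using heavy_cellsD(5)[OF e] by blast
  have l: "fst e \<in> lattice_lines" by (rule heavy_cellsD(1)[OF e])
  have sub: "P s \<subseteq> P (Suc T)" "Q (s - 1) \<subseteq> Q T" "P a \<subseteq> P s" "Q s \<subseteq> Q T"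
    using s by (simp_all add: P_mono Q_mono)
  define J' where "J' = line_cell (Q (s - 1)) (fst e) f"
  have fJ: "f \<in> snd e" "f \<in> J'"
    unfolding J J'_def using f sub by (auto intro!: in_line_cell_self[OF l])
  have JJ: "snd e \<subseteq> J'" using fJ unfolding J J'_def by (intro line_cell_mono[OF sub(2)])
  have fin: "finite (P s)" using s finite_P by simp
  have ge: "w \<le> real (card (snd e \<inter> P s))"
  proof -
    have "card (snd e \<inter> P a) \<le> card (snd e \<inter> P s)" using fin sub by (intro card_mono) auto
    then show ?thesis using a by linarith
  qed
  have "card (snd e \<inter> P s) \<le> card (J' \<inter> P s)" using fin JJ by (intro card_mono) auto
  then have "(fst e, J') \<in> heavy_cells w (P s) (Q (s - 1))"
    using l f ge sub unfolding heavy_cells_def J'_def by auto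
  then have "confines h (P s) (fst e) J' (X s)"
    using S_confined[OF s1 s(2), of "(fst e, J')"] unfolding S by simp
  then have "card (line_cell (Q T) (fst e) f \<inter> J' \<inter> P s) \<le> 2 * h"
    by (rule confinesD) (use X_subset[OF s1] sub f fJ in auto)
  moreover have "line_cell (Q T) (fst e) f \<inter> J' = snd e" using JJ unfolding J by blast
  ultimately show False using ge h_w by simp
qed

text \<open>Distinct cells share at most one point, also after restriction to \<open>A\<close>.
  Early in the game \<open>A\<close> will consist of all Maker points, later only of recent
  ones.\<close>

lemma card_heavy_cells_le:
  assumes A: "A \<subseteq> P (Suc T)" "real (card A) \<le> N" and v: "v > 0" "2 * N / v + 1 \<le> v"
    and gain: "\<And>e. e \<in> heavy_cells w' (P (Suc T)) (Q T) \<Longrightarrow> v \<le> real (card (snd e \<inter> A))"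
  shows "real (card (heavy_cells w' (P (Suc T)) (Q T))) \<le> 2 * N / v"
proof (rule few_almost_disjoint_sets[where X = A and A = "\<lambda>e. snd e \<inter> A"])
  show "finite A" using A(1) finite_P[of "Suc T"] by (auto intro: finite_subset)
  fix i j assume "i \<in> heavy_cells w' (P (Suc T)) (Q T)" "j \<in> heavy_cells w' (P (Suc T)) (Q T)" "i \<noteq> j"
  from heavy_cells_meet[OF this] show "card ((snd i \<inter> A) \<inter> (snd j \<inter> A)) \<le> 1"
    by (intro card_le_1I) blast
qed (use A v gain in auto)

end

section \<open>Asymptotic bound on the number of heavy cells\<close>

lemma le_div_natI:
  assumes "real c \<le> real t / real d" "d > 0"
  shows "c \<le> t div d"
proof -
  have "real (c * d) \<le> real t" using assms by (simp add: pos_le_divide_eq)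
  then show ?thesis using assms(2) by (simp only: of_nat_le_iff less_eq_div_iff_mult_less_eq)
qed

lemma few_heavy_cells:
  fixes \<delta> :: real and d :: nat
  assumes \<delta>: "0 < \<delta>" "\<delta> < 1" and d: "d > 0"
  shows "\<forall>\<^sub>F n in sequentially. \<forall>P Q X S T.
    confining_play P Q X S (nat \<lfloor>\<delta> * real n / 8\<rfloor>) (\<delta> * real n / 2) (\<delta> * real n) (\<lambda>t. t div d) T \<longrightarrow>
    Suc T < n \<longrightarrow> card (heavy_cells (\<delta> * real n) (P (Suc T)) (Q T)) \<le> Suc T div d"
proof -
  \<comment> \<open>\<open>c\<close> makes the early estimate \<open>4 * c * t / \<delta>\<close>
    equal to \<open>t / d\<close>, and \<open>\<beta>\<close> makes the late estimate
    \<open>8 * \<beta> * n / \<delta>\<close> equal to \<open>c * n / (4 * d)\<close>. Saturation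
    over \<open>W\<close> timesteps would force at least \<open>2 * \<gamma> * n ^ 3\<close> charged
    incidences, twice what is possible.\<close>
  define c where "c = \<delta> / (4 * real d)"
  define \<beta> where "\<beta> = c * \<delta> / (32 * real d)"
  define \<gamma> where "\<gamma> = \<beta> * c * \<delta> / (32 * real d)"
  have c: "c > 0" "c \<le> \<delta> / 4" using \<delta> d by (auto simp: c_def field_simps)
  have \<beta>: "\<beta> > 0" "\<beta> \<le> c / 32" "\<beta> \<le> \<delta> * \<delta> / 128"
  proof -
    show "\<beta> > 0" using c \<delta> d by (auto simp: \<beta>_def)
    have "\<delta> / (32 * real d) \<le> 1 / 32" using \<delta> d by (simp add: field_simps)
    then have "c * (\<delta> / (32 * real d)) \<le> c * (1 / 32)" using c by (intro mult_left_mono) auto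
    then show "\<beta> \<le> c / 32" by (simp add: \<beta>_def)
    have "c * (\<delta> / (32 * real d)) \<le> (\<delta> / 4) * (\<delta> / 32)"
      using c \<delta> d by (intro mult_mono) (auto simp: field_simps)
    then show "\<beta> \<le> \<delta> * \<delta> / 128" by (simp add: \<beta>_def)
  qed
  have \<gamma>: "\<gamma> > 0" using \<beta> c \<delta> d by (simp add: \<gamma>_def)
  have ev: "\<forall>\<^sub>F n in sequentially. x \<le> real n" for x
    using filterlim_real_sequentially unfolding filterlim_at_top by blast
  have rich: "\<forall>\<^sub>F n in sequentially. \<forall>X. finite X \<longrightarrow> card X \<le> n\<^sup>2 \<longrightarrow>
    (\<Sum>l | l \<in> lattice_lines \<and> \<delta> / 2 * real n \<le> real (card (l \<inter> X)). real (card (l \<inter> X))) \<le> \<gamma> * real n ^ 3"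
    using \<delta> \<gamma> by (intro rich_line_incidences) auto
  show ?thesis
    using rich ev[of "4 / \<delta>"] ev[of "2 / \<beta>"] ev[of "2 * real d / c"] ev[of "2 / c"]
  proof eventually_elim
    case (elim n)
    have n: "\<delta> * real n \<ge> 4" "\<beta> * real n \<ge> 2" "c * real n \<ge> 2 * real d" "c * real n \<ge> 2"
      using elim(2-) \<delta> \<beta> c by (simp_all add: field_simps)
    have n0: "real n > 0" using \<delta> by (intro less_le_trans[OF _ elim(2)]) simp
    show ?case
    proof (intro allI impI)
      fix P Q X S T
      assume "confining_play P Q X S (nat \<lfloor>\<delta> * real n / 8\<rfloor>) (\<delta> * real n / 2) (\<delta> * real n) (\<lambda>t. t div d) T"
        and T: "Suc T < n"
      then interpret confining_play P Q X S "nat \<lfloor>\<delta> * real n / 8\<rfloor>" "\<delta> * real n / 2" "\<delta> * real n" "\<lambda>t. t div d" T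
        by simp
      define t where "t = Suc T"
      have tn: "real t \<le> real n" "real t \<ge> 1" using T by (auto simp: t_def)
      let ?H = "heavy_cells (\<delta> * real n) (P (Suc T)) (Q T)"
      have "real (card ?H) \<le> real t / real d"
      proof (cases "real t \<le> 2 * c * real n")
        case True
        have "2 * (real t * real t) / (\<delta> * real n) + 1 \<le> \<delta> * real n"
        proof -
          have "real t * real t \<le> (2 * c * real n) * (2 * c * real n)"
            using True by (intro mult_mono) auto
          also have "\<dots> = 4 * (c * c) * (real n * real n)" by simp
          also have "\<dots> \<le> 4 * (\<delta> / 4 * (\<delta> / 4)) * (real n * real n)"
            using c by (intro mult_right_mono mult_left_mono mult_mono) auto
          also have "\<dots> = (\<delta> * real n) * (\<delta> * real n) / 4" by simp
          finally have "2 * (real t * real t) / (\<delta> * real n) \<le> \<delta> * real n / 2"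
            using n(1) by (simp add: divide_le_eq)
          then show ?thesis using n(1) by linarith
        qed
        moreover have "real (card (P (Suc T))) \<le> real t * real t"
          using card_P[of "Suc T"] unfolding t_def by (metis of_nat_le_iff of_nat_mult order_refl)
        ultimately have "real (card ?H) \<le> 2 * (real t * real t) / (\<delta> * real n)"
          using n(1) by (intro card_heavy_cells_le[of "P (Suc T)"]) (auto dest: heavy_cellsD(4))
        also have "\<dots> \<le> 2 * (real t * (2 * c * real n)) / (\<delta> * real n)"
          using True n(1) by (intro divide_right_mono mult_left_mono) auto
        also have "\<dots> = real t / real d" using n0 \<delta> d by (simp add: c_def field_simps)
        finally show ?thesis .
      next
        case late: False
        \<comment> \<open>The last \<open>W\<close> timesteps up to \<open>T\<close> are examined;
          as the game is late, all of them have number at least \<open>c * n\<close>.\<close>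
        define W where "W = nat \<lfloor>\<beta> * real n\<rfloor>"
        define a where "a = T - W"
        have W: "real W \<le> \<beta> * real n" "\<beta> * real n - 1 < real W" using n(2) unfolding W_def by linarith+
        have \<beta>n: "\<beta> * real n \<le> c * real n / 32"
          using mult_right_mono[OF \<beta>(2), of "real n"] by simp
        have WT: "W \<le> T" and a: "c * real n \<le> real (Suc a)"
        proof -
          have "real W + c * real n \<le> real T" using late W \<beta>n n(4) unfolding t_def by auto
          then show "W \<le> T" "c * real n \<le> real (Suc a)" unfolding a_def using n(4) by linarith+
        qed
        have aT: "a \<le> T" "T - a = W" using WT by (auto simp: a_def)
        \<comment> \<open>The points of Maker's last \<open>W + 1\<close> turns, each of fewer than
          \<open>n\<close> points. The factor 2 in \<open>N\<close> absorbs the extra turn.\<close>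
        define A where "A = P (Suc T) - P a"
        define N where "N = 2 * \<beta> * real n * real n"
        have AN: "real (card A) \<le> N"
        proof -
          have "card A \<le> (Suc T - a) * Suc T" unfolding A_def using aT by (intro P_growth) auto
          also have "Suc T - a = Suc W" using aT by simp
          finally have "real (card A) \<le> real (Suc W) * real t" unfolding t_def by (metis of_nat_le_iff of_nat_mult)
          also have "\<dots> \<le> (2 * \<beta> * real n) * real n"
            using W n(2) tn by (intro mult_mono) auto
          finally show ?thesis by (simp add: N_def)
        qed
        have Nv: "2 * N / (\<delta> * real n / 2) = 8 * \<beta> * real n / \<delta>"
          using n0 \<delta> by (simp add: N_def field_simps)
        have cond: "2 * N / (\<delta> * real n / 2) + 1 \<le> \<delta> * real n / 2"
        proof -
          have "8 * \<beta> * real n / \<delta> \<le> 8 * (\<delta> * \<delta> / 128) * real n / \<delta>"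
            using \<beta> \<delta> by (intro divide_right_mono mult_right_mono mult_left_mono) auto
          also have "\<dots> = \<delta> * real n / 16" using \<delta> by simp
          finally show ?thesis unfolding Nv using n(1) by linarith
        qed
        have gain: "\<delta> * real n / 2 \<le> real (card (snd e \<inter> A))" if e: "e \<in> ?H" for e
        proof (rule ccontr)
          assume less: "\<not> ?thesis"
          have "card (snd e \<inter> P (Suc T)) \<le> card ((snd e \<inter> P a) \<union> (snd e \<inter> A))"
            using finite_P[of "Suc T"] finite_P[of a] aT by (intro card_mono) (auto simp: A_def)
          also have "\<dots> \<le> card (snd e \<inter> P a) + card (snd e \<inter> A)" by (rule card_Un_le)
          finally have "\<delta> * real n / 2 \<le> real (card (snd e \<inter> P a))"
            using heavy_cellsD(4)[OF e] less by linarith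
          then have sat: "card (S s) = s div d" if "s \<in> {Suc a..T}" for s
            using saturated_if_cell_persists[OF e] that by auto
          \<comment> \<open>Rounding down the budget loses less than 1, hence at most half of
            \<open>c * n / d\<close>.\<close>
          have lower: "c * real n / (2 * real d) \<le> real (card (S s))" if s: "s \<in> {Suc a..T}" for s
          proof -
            have "real s / real d - 1 \<le> real (s div d)"
              using floor_divide_of_nat_eq[of s d, where 'a = real] by linarith
            moreover have "c * real n / real d \<le> real s / real d"
              using s a d by (intro divide_right_mono) auto
            moreover have "1 \<le> c * real n / (2 * real d)" using n(3) d by (simp add: le_divide_eq)
            ultimately show ?thesis using sat[OF s] d by (simp add: field_simps)
          qed
          have "real W * (c * real n / (2 * real d)) = (\<Sum>s=Suc a..T. c * real n / (2 * real d))"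
            using aT by simp
          also have "\<dots> \<le> (\<Sum>s=Suc a..T. real (card (S s)))" by (rule sum_mono) (rule lower)
          also have "\<dots> \<le> (\<Sum>s=1..T. real (card (S s)))" by (rule sum_mono2) auto
          finally have "real W * (c * real n / (2 * real d)) \<le> real (\<Sum>s=1..T. card (S s))" by simp
          moreover have h4: "\<delta> * real n / 4 \<le> \<delta> * real n / 2 - 2 * real (nat \<lfloor>\<delta> * real n / 8\<rfloor>)"
            using n(1) by linarith
          ultimately have "real W * (c * real n / (2 * real d)) * (\<delta> * real n / 4) \<le>
              real (\<Sum>s=1..T. card (S s)) * (\<delta> * real n / 2 - 2 * real (nat \<lfloor>\<delta> * real n / 8\<rfloor>))"
            using n(1) by (intro mult_mono) (auto intro!: sum_nonneg)
          also have "\<dots> \<le> (\<Sum>l | l \<in> lattice_lines \<and> \<delta> * real n / 2 \<le> real (card (l \<inter> P T)). real (card (l \<inter> P T)))"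
            by (rule processed_cells_bound)
          also have "\<dots> \<le> \<gamma> * real n ^ 3"
          proof -
            have "card (P T) \<le> T * T" by (rule card_P) simp
            also have "\<dots> \<le> n\<^sup>2" unfolding power2_eq_square using T by (intro mult_le_mono) auto
            finally show ?thesis using elim(1) finite_P[of T] by simp
          qed
          finally have "real W * (c * real n / (2 * real d)) * (\<delta> * real n / 4) \<le> \<gamma> * real n ^ 3" .
          moreover have "(\<beta> * real n / 2) * ((c * real n / (2 * real d)) * (\<delta> * real n / 4)) \<le>
              real W * ((c * real n / (2 * real d)) * (\<delta> * real n / 4))"
            using W n c \<delta> by (intro mult_right_mono) auto
          moreover have "(\<beta> * real n / 2) * ((c * real n / (2 * real d)) * (\<delta> * real n / 4)) = 2 * (\<gamma> * real n ^ 3)"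
            using d by (simp add: \<gamma>_def power3_eq_cube field_simps)
          ultimately have "2 * (\<gamma> * real n ^ 3) \<le> \<gamma> * real n ^ 3" by (simp add: mult.assoc)
          moreover have "\<gamma> * real n ^ 3 > 0" using \<gamma> n0 by simp
          ultimately show False by linarith
        qed
        have "real (card ?H) \<le> 2 * N / (\<delta> * real n / 2)"
          by (rule card_heavy_cells_le[OF _ AN _ cond gain]) (use n(1) in \<open>auto simp: A_def\<close>)
        also have "\<dots> = c * real n / (4 * real d)" unfolding Nv using \<delta> d by (simp add: \<beta>_def field_simps)
        also have "\<dots> \<le> (4 * real t) / (4 * real d)"
          using late c n0 d by (intro divide_right_mono) auto
        also have "\<dots> = real t / real d" by simp
        finally show ?thesis .
      qed
      then show "card ?H \<le> Suc T div d" unfolding t_def using d by (intro le_div_natI)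
    qed
  qed
qed

section \<open>The strategy\<close>

text \<open>Once Maker has won, cells may be too heavy to be confined within the budget; then any legal
  reply will do.\<close>

definition breaker_reply :: "nat \<Rightarrow> nat \<Rightarrow> real \<Rightarrow> real \<Rightarrow> nat \<Rightarrow> nat \<Rightarrow> point set \<Rightarrow> point set \<Rightarrow> turn" where
  "breaker_reply n h w w' d t P Q = (SOME X. legal_turn t (P \<union> Q) X \<and>
     (\<not> line_win n P Q \<longrightarrow> (\<exists>S. good_reply h w w' (t div d) P Q X S)))"

definition confining_strategy :: "nat \<Rightarrow> nat \<Rightarrow> real \<Rightarrow> real \<Rightarrow> nat \<Rightarrow> breaker_strategy" where
  "confining_strategy n h w w' d H m = breaker_reply n h w w' d (Suc (length H))
     (m \<union> \<Union> (fst ` set H)) (\<Union> (snd ` set H))"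

lemma claimed_mono: "s \<le> t \<Longrightarrow> claimed A s \<subseteq> claimed A t"
  unfolding claimed_def by (intro UN_mono) auto

lemma claimed_Suc: "claimed A (Suc t) = claimed A t \<union> A (Suc t)"
  unfolding claimed_def by (auto simp: atLeastAtMostSuc_conv)

lemma claimed_0: "claimed A 0 = {}"
  by (simp add: claimed_def)

lemma confining_strategy_history:
  assumes "t \<ge> 1"
  shows "confining_strategy n h w w' d (history M B t) (M t) =
    breaker_reply n h w w' d t (claimed M t) (claimed B (t - 1))"
proof -
  obtain s where t: "t = Suc s" using assms by (cases t) auto
  have "set (history M B t) = (\<lambda>s. (M s, B s)) ` {1..s}" unfolding history_def t by auto
  then have "\<Union> (fst ` set (history M B t)) = claimed M s" "\<Union> (snd ` set (history M B t)) = claimed B s"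
    unfolding claimed_def by (auto simp: image_image)
  moreover have "length (history M B t) = s" unfolding history_def t by simp
  ultimately show ?thesis unfolding confining_strategy_def t claimed_Suc by (simp add: Un_commute)
qed

text \<open>The choice in \<open>breaker_reply\<close> succeeds: without a win each heavy cell has
  fewer than \<open>n\<close> Maker points and costs at most \<open>d\<close>, so
  \<open>t div d\<close> of them fit into a turn.\<close>

lemma breaker_reply:
  assumes "finite P" "finite Q" "h > 0" "1 < w" "w \<le> w'" "d > 0" "2 * (n div h) \<le> d"
  shows "legal_turn t (P \<union> Q) (breaker_reply n h w w' d t P Q) \<and>
    (\<not> line_win n P Q \<longrightarrow> (\<exists>S. good_reply h w w' (t div d) P Q (breaker_reply n h w w' d t P Q) S))"
  unfolding breaker_reply_def
proof (rule someI_ex, cases "line_win n P Q")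
  case True
  obtain Y where "legal_turn t (P \<union> Q) Y"
    using exists_legal_extension[of "P \<union> Q" "{}" t] assms by auto
  with True show "\<exists>X. legal_turn t (P \<union> Q) X \<and>
     (\<not> line_win n P Q \<longrightarrow> (\<exists>S. good_reply h w w' (t div d) P Q X S))" by blast
next
  case False
  have "card (J \<inter> P) \<le> n" if e: "(l, J) \<in> heavy_cells w P Q" for l J
  proof -
    obtain f where "J = line_cell Q l f" using heavy_cellsD(5)[OF e] by auto
    then show ?thesis
      using card_cell_less_if_no_win[OF False, of l f] heavy_cellsD(1)[OF e] by simp
  qed
  moreover have "t div d * (2 * (n div h)) \<le> t"
  proof -
    have "t div d * (2 * (n div h)) \<le> t div d * d" using assms(7) by (rule mult_le_mono2)
    also have "\<dots> \<le> t" by simp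
    finally show ?thesis .
  qed
  ultimately show "\<exists>X. legal_turn t (P \<union> Q) X \<and>
     (\<not> line_win n P Q \<longrightarrow> (\<exists>S. good_reply h w w' (t div d) P Q X S))"
    using exists_good_reply[of P Q h w w' n "t div d" t] assms by blast
qed

text \<open>\<open>play\<close> demands legality from Maker only, so finiteness of Breaker's turns
  is derived from the strategy during the induction.\<close>

lemma play_finite_claimed:
  assumes play: "play (confining_strategy n h w w' d) M B T" and t: "t \<le> T"
    and params: "h > 0" "1 < w" "w \<le> w'" "d > 0" "2 * (n div h) \<le> d"
  shows "finite (claimed M t) \<and> finite (claimed B t)"
  using t
proof (induction t)
  case 0
  then show ?case by (simp add: claimed_0)
next
  case (Suc t)
  have "legal_maker_turn M B (Suc t)"
    and B: "B (Suc t) = confining_strategy n h w w' d (history M B (Suc t)) (M (Suc t))"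
    using play Suc.prems unfolding play_def by auto
  then have M: "finite (claimed M (Suc t))"
    using Suc by (simp add: legal_maker_turn_def legal_turn_def claimed_Suc)
  have "B (Suc t) = breaker_reply n h w w' d (Suc t) (claimed M (Suc t)) (claimed B t)"
    unfolding B by (simp add: confining_strategy_history)
  then have "finite (B (Suc t))"
    using breaker_reply[OF M _ params, of "claimed B t" "Suc t"] Suc by (simp add: legal_turn_def)
  with M Suc show ?case by (simp add: claimed_Suc)
qed

lemma play_reply:
  assumes play: "play (confining_strategy n h w w' d) M B T" and t: "1 \<le> t" "t \<le> T"
    and params: "h > 0" "1 < w" "w \<le> w'" "d > 0" "2 * (n div h) \<le> d"
  shows "legal_turn t (claimed M t \<union> claimed B (t - 1)) (B t)"
    "\<not> line_win n (claimed M t) (claimed B (t - 1)) \<Longrightarrow>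
       \<exists>S. good_reply h w w' (t div d) (claimed M t) (claimed B (t - 1)) (B t) S"
proof -
  have "B t = breaker_reply n h w w' d t (claimed M t) (claimed B (t - 1))"
    using play t confining_strategy_history[OF t(1)] unfolding play_def by auto
  then show "legal_turn t (claimed M t \<union> claimed B (t - 1)) (B t)"
    "\<not> line_win n (claimed M t) (claimed B (t - 1)) \<Longrightarrow>
       \<exists>S. good_reply h w w' (t div d) (claimed M t) (claimed B (t - 1)) (B t) S"
    using breaker_reply[of "claimed M t" "claimed B (t - 1)" h w w' d n t]
      play_finite_claimed[OF play _ params] t params by auto
qed

lemma legal_confining_strategy:
  assumes "h > 0" "1 < w" "w \<le> w'" "d > 0" "2 * (n div h) \<le> d"
  shows "legal_strategy (confining_strategy n h w w' d)"
  unfolding legal_strategy_def legal_breaker_turn_def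
  using play_reply(1)[OF _ _ _ assms] by auto

lemma play_growth:
  assumes "play \<sigma> M B T" "s \<le> t" "t \<le> T"
  shows "card (claimed M t - claimed M s) \<le> (t - s) * t"
proof -
  have M: "finite (M r) \<and> card (M r) = r" if "r \<in> {s<..t}" for r
    using assms that unfolding play_def legal_maker_turn_def legal_turn_def by auto
  have "claimed M t - claimed M s \<subseteq> (\<Union>r\<in>{s<..t}. M r)" unfolding claimed_def by force
  then have "card (claimed M t - claimed M s) \<le> card (\<Union>r\<in>{s<..t}. M r)"
    using M by (intro card_mono) auto
  also have "\<dots> \<le> (\<Sum>r\<in>{s<..t}. card (M r))" by (rule card_UN_le) simp
  also have "\<dots> \<le> (\<Sum>r\<in>{s<..t}. t)" using M by (intro sum_mono) auto
  also have "\<dots> = (t - s) * t" by simp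
  finally show ?thesis .
qed

text \<open>The induction is strong because \<open>few\<close> needs good replies at all earlier
  timesteps, and these are guaranteed only as long as Maker has not won.\<close>

lemma confining_strategy_no_line_win:
  fixes n h d :: nat and w w' :: real
  assumes params: "h > 0" "1 < w" "w \<le> w'" "d > 0" "2 * (n div h) \<le> d" and h: "2 * real h < w" and n: "n > 0"
    and few: "\<And>P Q X S T. confining_play P Q X S h w w' (\<lambda>t. t div d) T \<Longrightarrow> Suc T < n \<Longrightarrow>
      card (heavy_cells w' (P (Suc T)) (Q T)) \<le> Suc T div d"
    and play: "play (confining_strategy n h w w' d) M B T"
  shows "t \<le> T \<Longrightarrow> w' + real t \<le> real n \<Longrightarrow> \<not> line_win n (claimed M t) (claimed B (t - 1))"
proof (induction t rule: less_induct)
  case (less t)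
  let ?P = "claimed M" and ?Q = "claimed B"
  note fin = play_finite_claimed[OF play _ params]
  show ?case
  proof (cases t)
    case 0
    have "\<not> line_win n {} Q" for Q
    proof
      assume "line_win n {} Q"
      then obtain S :: "point set" where "S \<subseteq> {}" "card S = n" by (rule line_winE) blast
      then show False using n by simp
    qed
    then show ?thesis by (simp add: 0 claimed_0)
  next
    case (Suc s)
    have nowin: "\<not> line_win n (?P r) (?Q (r - 1))" if "r \<le> s" for r
      using less Suc that by auto
    have "\<exists>S. good_reply h w w' (r div d) (?P r) (?Q (r - 1)) (B r) S" if "1 \<le> r" "r \<le> s" for r
      using play_reply(2)[OF play _ _ params, of r] nowin[of r] that less.prems Suc by simp
    then obtain S where S: "\<And>r. 1 \<le> r \<Longrightarrow> r \<le> s \<Longrightarrow>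
        good_reply h w w' (r div d) (?P r) (?Q (r - 1)) (B r) (S r)"
      by metis
    have heavy: "heavy_cells w' (?P s) (?Q s) = {}"
    proof (cases s)
      case 0
      show ?thesis
      proof (rule equals0I)
        fix e assume "e \<in> heavy_cells w' (?P s) (?Q s)"
        from heavy_cellsD(4)[OF this] show False using params 0 by (simp add: claimed_0)
      qed
    next
      case (Suc r)
      \<comment> \<open>In this instance Maker's turn of timestep \<open>s = Suc r\<close> is made
        and Breaker's reply to it is pending, so \<open>few\<close> bounds the cells that this reply
        has to confine.\<close>
      have "confining_play ?P ?Q B S h w w' (\<lambda>t. t div d) r"
      proof
        show "\<And>t. 1 \<le> t \<Longrightarrow> B t \<subseteq> ?Q t" unfolding claimed_def by auto
        show "\<And>t. t \<le> Suc r \<Longrightarrow> finite (?P t)" using fin less.prems \<open>t = Suc s\<close> Suc by simp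
        show "\<And>s t. s \<le> t \<Longrightarrow> t \<le> Suc r \<Longrightarrow> card (?P t - ?P s) \<le> (t - s) * t"
          using play_growth[OF play] less.prems \<open>t = Suc s\<close> Suc by simp
        show "\<And>t. 1 \<le> t \<Longrightarrow> t \<le> r \<Longrightarrow> good_reply h w w' (t div d) (?P t) (?Q (t - 1)) (B t) (S t)"
          using S Suc by simp
      qed (use claimed_mono claimed_0 h params in auto)
      moreover have "Suc r < n" using less.prems \<open>t = Suc s\<close> Suc params by linarith
      ultimately have "card (heavy_cells w' (?P s) (?Q r)) \<le> s div d" using few Suc by blast
      then show ?thesis
        using S[of s] fin[of s] Suc less.prems \<open>t = Suc s\<close> params h
        by (intro no_heavy_cells_after_reply[of h w w' "s div d" "?P s" "?Q r" "B s" "S s"])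
          (auto simp: claimed_Suc)
    qed
    have "legal_turn t (?P s \<union> ?Q s) (M t)"
      using bspec[OF play[unfolded play_def legal_maker_turn_def], of t] less.prems Suc by simp
    then have "\<not> line_win n (?P s \<union> M t) (?Q s)"
      using nowin[of s] less.prems Suc fin[of s] claimed_mono[of "s - 1" s B]
      by (intro no_line_win_step[OF heavy]) (auto simp: legal_turn_def dest: line_win_antimono)
    then show ?thesis by (simp add: Suc claimed_Suc)
  qed
qed

theorem theorem1:
  fixes \<delta> :: real
  assumes "\<delta> > 0"
  shows "\<exists>N. \<forall>n\<ge>N. \<exists>\<sigma>. legal_strategy \<sigma> \<and> no_win_before \<sigma> n ((1 - \<delta>) * real n)"
proof -
  \<comment> \<open>\<open>few_heavy_cells\<close> needs a parameter below 1, and a smaller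
    parameter gives a stronger conclusion.\<close>
  define \<epsilon> where "\<epsilon> = min \<delta> (1 / 2)"
  have \<epsilon>: "0 < \<epsilon>" "\<epsilon> < 1" "\<epsilon> \<le> \<delta>" using assms by (auto simp: \<epsilon>_def)
  \<comment> \<open>The cost \<open>2 * (n div h)\<close> of confining one cell will be at most
    \<open>32 / \<epsilon>\<close>, because \<open>h \<ge> \<epsilon> * n / 16\<close>.\<close>
  define d where "d = nat \<lceil>32 / \<epsilon>\<rceil>"
  have d: "d > 0" "32 / \<epsilon> \<le> real d" using \<epsilon> by (auto simp: d_def)
  have ev: "\<forall>\<^sub>F n in sequentially. x \<le> real n" for x
    using filterlim_real_sequentially unfolding filterlim_at_top by blast
  have "\<forall>\<^sub>F n in sequentially. \<exists>\<sigma>. legal_strategy \<sigma> \<and> no_win_before \<sigma> n ((1 - \<delta>) * real n)"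
    using few_heavy_cells[OF \<epsilon>(1,2) d(1)] ev[of "16 / \<epsilon>"] ev[of 2]
  proof eventually_elim
    case (elim n)
    \<comment> \<open>Thus \<open>2 * h\<close> is at most half of the weight
      \<open>\<epsilon> * n / 2\<close>, and a confined piece falls well below that weight.\<close>
    define h where "h = nat \<lfloor>\<epsilon> * real n / 8\<rfloor>"
    have n: "\<epsilon> * real n \<ge> 16" "n \<ge> 2" using elim(2,3) \<epsilon> by (auto simp: field_simps)
    have h: "\<epsilon> * real n / 16 \<le> real h" "real h \<le> \<epsilon> * real n / 8" "h > 0"
      using n(1) unfolding h_def by linarith+
    have "real (n div h) \<le> real n / real h"
      using floor_divide_of_nat_eq[of n h, where 'a = real] by linarith
    also have "\<dots> \<le> real n / (\<epsilon> * real n / 16)" using h n by (intro divide_left_mono) auto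
    also have "\<dots> = 16 / \<epsilon>" using n by simp
    finally have nd: "2 * (n div h) \<le> d" using d(2) by linarith
    have params: "h > 0" "1 < \<epsilon> * real n / 2" "\<epsilon> * real n / 2 \<le> \<epsilon> * real n" "d > 0" "2 * (n div h) \<le> d"
      using h n d nd by auto
    let ?\<sigma> = "confining_strategy n h (\<epsilon> * real n / 2) (\<epsilon> * real n) d"
    have "\<not> winning_segment n (claimed M t) (claimed B (t - 1))"
      if play: "play ?\<sigma> M B T" and t: "t \<in> {1..T}" "real t < (1 - \<delta>) * real n" for M B T t
    proof -
      have "\<epsilon> * real n \<le> \<delta> * real n" using \<epsilon>(3) by (rule mult_right_mono) simp
      then have "\<epsilon> * real n + real t \<le> real n" using t(2) by (simp add: algebra_simps)
      moreover have "2 * real h < \<epsilon> * real n / 2" using h(2) n(1) by linarith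
      moreover have "n > 0" using n(2) by simp
      ultimately have "\<not> line_win n (claimed M t) (claimed B (t - 1))"
        using confining_strategy_no_line_win[OF params _ _ _ play, of t] elim(1) t(1) by (auto simp: h_def)
      then show ?thesis using line_win_if_winning_segment[OF n(2)] by blast
    qed
    then have "no_win_before ?\<sigma> n ((1 - \<delta>) * real n)" unfolding no_win_before_def by blast
    then show ?case using legal_confining_strategy[OF params] by blast
  qed
  then show ?thesis unfolding eventually_sequentially by blast
qed

end
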